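(* There is a functor $\mathrm{fSpcnt}\colon \mathsf{tcat}^{\mathrm{op}}\to\mathsf{Sob}$ and an associated notion of support $\mathrm{supp}$ (both as specified in the context), such that for each $\mathsf{K}\in\mathsf{tcat}$ the pair $(\mathrm{fSpcnt}\,\mathsf{K},\mathrm{supp})$ is the terminal support theory. That is: $\mathrm{supp}\colon \mathrm{Ob}\,\mathsf{K}\to\mathcal{O}(\mathrm{fSpcnt}\,\mathsf{K})$ is a $\vee$-support datum on $\mathsf{K}$, and for every sober space $X$ and every $\vee$-support datum $\sigma$ on $\mathsf{K}$ with values in $X$ there is a unique continuous map $f\colon X\to\mathrm{fSpcnt}\,\mathsf{K}$ such that $\sigma(x)=f^{-1}(\mathrm{supp}(x))$ for all $x\in\mathsf{K}$.
   Context: $\mathsf{tcat}$ is the category of essentially small triangulated categories and exact functors; $\mathsf{Sob}$ is the category of sober spaces and continuous maps; $\mathcal{O}(X)$ is the lattice of open subsets of $X$. A thick subcategory is a full subcategory closed under isomorphisms, suspensions, cones and direct summands; $\mathrm{thick}(C)$ is the smallest thick subcategory containing $C$. $T(\mathsf{K})=\mathrm{Thick}(\mathsf{K})$ is the complete lattice of thick subcategories of $\mathsf{K}$ under inclusion. $\mathsf{CjSLat}$ is the category of complete lattices and poset maps preserving arbitrary joins (including the bottom). An exact functor $F\colon\mathsf{K}\to\mathsf{L}$ induces $T(F)\colon T(\mathsf{K})\to T(\mathsf{L})$, $\mathsf{M}\mapsto\mathrm{thick}(F\mathsf{M})$, which makes $T$ a functor $\mathsf{tcat}\to\mathsf{CjSLat}$.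 A frame is a complete lattice in which finite meets distribute over arbitrary joins; frame maps preserve finite meets and arbitrary joins; $\mathbf{2}=\{0\le1\}$; a frame is spatial if frame maps to $\mathbf{2}$ separate: whenever $a\nleq b$ there is a frame map $p$ to $\mathbf 2$ with $p(a)=1,p(b)=0$. $\mathsf{SFrm}$ is the category of spatial frames and frame maps. The forgetful functor $i\colon\mathsf{SFrm}\to\mathsf{CjSLat}$ has a left adjoint $d$, and Stone duality gives an equivalence $\mathrm{pt}\colon\mathsf{SFrm}^{\mathrm{op}}\to\mathsf{Sob}$, where $\mathrm{pt}(F)$ is the set of frame maps $F\to\mathbf{2}$ with open sets $\{p\mid p(l)=1\}$, $l\in F$. The functor $\mathrm{fSpcnt}$ is the composite $\mathsf{tcat}^{\mathrm{op}}\xrightarrow{T^{\mathrm{op}}}\mathsf{CjSLat}^{\mathrm{op}}\xrightarrow{d^{\mathrm{op}}}\mathsf{SFrm}^{\mathrm{op}}\xrightarrow{\mathrm{pt}}\mathsf{Sob}$. The support $\mathrm{supp}(x)$ of $x\in\mathsf{K}$ is the open subset of $\mathrm{fSpcnt}\,\mathsf{K}$ corresponding, under $dT(\mathsf{K})\cong\mathcal{O}(\mathrm{fSpcnt}\,\mathsf{K})$, to the image of $\mathrm{thick}(x)$ under the unit $T(\mathsf{K})\to i\,d\,T(\mathsf{K})$. For a sober space $X$, a $\vee$-support datum on $\mathsf{K}$ with values in $X$ is a map $\sigma\colon\mathrm{Ob}\,\mathsf{K}\to\mathcal{O}(X)$ such that for all $x,y\in\mathsf{K}$: (i) $\sigma(0)=\varnothing$;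 (ii) $\sigma(\Sigma^ix)=\sigma(x)$ for all $i\in\mathbb{Z}$; (iii) $\sigma(x\oplus y)=\sigma(x)\cup\sigma(y)$; (iv) for every triangle $x\to y\to z$ one has $\sigma(y)\subseteq\sigma(x)\cup\sigma(z)$. *)

theory Defs
  imports "HOL-Analysis.Abstract_Topology" "HOL-Algebra.Group" "HOL-Algebra.Complete_Lattice"
begin

section \<open>Additive categories\<close>

record ('o, 'm) category =
  Obj :: "'o set"
  Arr :: "'m set"
  Dom :: "'m \<Rightarrow> 'o"
  Cod :: "'m \<Rightarrow> 'o"
  Id :: "'o \<Rightarrow> 'm"
  Comp :: "'m \<Rightarrow> 'm \<Rightarrow> 'm" (infixl \<open>\<cdot>\<index>\<close> 70)

definition Hom :: "('o, 'm, 'z) category_scheme \<Rightarrow> 'o \<Rightarrow> 'o \<Rightarrow> 'm set" where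
  "Hom C a b = {f \<in> Arr C. Dom C f = a \<and> Cod C f = b}"

locale category =
  fixes C :: "('o, 'm, 'z) category_scheme" (structure)
  assumes Dom_in_Obj: "f \<in> Arr C \<Longrightarrow> Dom C f \<in> Obj C"
    and Cod_in_Obj: "f \<in> Arr C \<Longrightarrow> Cod C f \<in> Obj C"
    and Id_in_Hom: "a \<in> Obj C \<Longrightarrow> Id C a \<in> Hom C a a"
    and Comp_in_Hom: "\<lbrakk>f \<in> Hom C a b; g \<in> Hom C b c\<rbrakk> \<Longrightarrow> g \<cdot> f \<in> Hom C a c"
    and Comp_Id_left: "f \<in> Hom C a b \<Longrightarrow> Id C b \<cdot> f = f"
    and Comp_Id_right: "f \<in> Hom C a b \<Longrightarrow> f \<cdot> Id C a = f"
    and Comp_assoc: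
      "\<lbrakk>f \<in> Hom C a b; g \<in> Hom C b c; h \<in> Hom C c d\<rbrakk> \<Longrightarrow> (h \<cdot> g) \<cdot> f = h \<cdot> (g \<cdot> f)"

definition is_iso :: "('o, 'm, 'z) category_scheme \<Rightarrow> 'm \<Rightarrow> bool" where
  "is_iso C f \<longleftrightarrow> f \<in> Arr C \<and>
     (\<exists>g \<in> Hom C (Cod C f) (Dom C f).
        g \<cdot>\<^bsub>C\<^esub> f = Id C (Dom C f) \<and> f \<cdot>\<^bsub>C\<^esub> g = Id C (Cod C f))"

definition isomorphic :: "('o, 'm, 'z) category_scheme \<Rightarrow> 'o \<Rightarrow> 'o \<Rightarrow> bool" where
  "isomorphic C a b \<longleftrightarrow> (\<exists>f \<in> Hom C a b. is_iso C f)"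

definition zero_object :: "('o, 'm, 'z) category_scheme \<Rightarrow> 'o \<Rightarrow> bool" where
  "zero_object C z \<longleftrightarrow> z \<in> Obj C \<and>
     (\<forall>a \<in> Obj C. (\<exists>!f. f \<in> Hom C z a) \<and> (\<exists>!f. f \<in> Hom C a z))"

record ('o, 'm) preadditive_category = "('o, 'm) category" +
  Add :: "'m \<Rightarrow> 'm \<Rightarrow> 'm" (infixl \<open>\<boxplus>\<index>\<close> 65)
  Zero :: "'o \<Rightarrow> 'o \<Rightarrow> 'm"

definition Hom_group ::
    "('o, 'm, 'z) preadditive_category_scheme \<Rightarrow> 'o \<Rightarrow> 'o \<Rightarrow> 'm monoid" where
  "Hom_group C a b = \<lparr>carrier = Hom C a b, monoid.mult = Add C, one = Zero C a b\<rparr>"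

definition Neg :: "('o, 'm, 'z) preadditive_category_scheme \<Rightarrow> 'm \<Rightarrow> 'm" where
  "Neg C f = inv\<^bsub>Hom_group C (Dom C f) (Cod C f)\<^esub> f"

definition direct_sum ::
    "('o, 'm, 'z) preadditive_category_scheme \<Rightarrow> 'o \<Rightarrow> 'o \<Rightarrow> 'o \<Rightarrow> bool" where
  "direct_sum C x y s \<longleftrightarrow>
     (\<exists>i \<in> Hom C x s. \<exists>j \<in> Hom C y s. \<exists>p \<in> Hom C s x. \<exists>q \<in> Hom C s y.
        p \<cdot>\<^bsub>C\<^esub> i = Id C x \<and> q \<cdot>\<^bsub>C\<^esub> j = Id C y \<and>
        q \<cdot>\<^bsub>C\<^esub> i = Zero C x y \<and> p \<cdot>\<^bsub>C\<^esub> j = Zero C y x \<and>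
        (i \<cdot>\<^bsub>C\<^esub> p) \<boxplus>\<^bsub>C\<^esub> (j \<cdot>\<^bsub>C\<^esub> q) = Id C s)"

locale additive_category = category C
  for C :: "('o, 'm, 'z) preadditive_category_scheme" (structure) +
  assumes Hom_comm_group: "\<lbrakk>a \<in> Obj C; b \<in> Obj C\<rbrakk> \<Longrightarrow> comm_group (Hom_group C a b)"
    and Comp_Add_left: "\<lbrakk>f \<in> Hom C a b; g \<in> Hom C b c; g' \<in> Hom C b c\<rbrakk>
          \<Longrightarrow> (g \<boxplus> g') \<cdot> f = (g \<cdot> f) \<boxplus> (g' \<cdot> f)"
    and Comp_Add_right: "\<lbrakk>f \<in> Hom C a b; f' \<in> Hom C a b; g \<in> Hom C b c\<rbrakk>
          \<Longrightarrow> g \<cdot> (f \<boxplus> f') = (g \<cdot> f) \<boxplus> (g \<cdot> f')"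
    and ex_zero_object: "\<exists>z. zero_object C z"
    and ex_direct_sum: "\<lbrakk>x \<in> Obj C; y \<in> Obj C\<rbrakk> \<Longrightarrow> \<exists>s. direct_sum C x y s"


section \<open>Functors\<close>

text \<open>Functors and natural transformations are extensional, so that HOL equality of the
  representing data is equality of functors and of transformations.\<close>

record ('o, 'm, 'p, 'n) func =
  omap :: "'o \<Rightarrow> 'p"
  amap :: "'m \<Rightarrow> 'n"

definition is_functor ::
    "('o, 'm, 'y) category_scheme \<Rightarrow> ('p, 'n, 'z) category_scheme
      \<Rightarrow> ('o, 'm, 'p, 'n, 'w) func_scheme \<Rightarrow> bool" where
  "is_functor C D F \<longleftrightarrow>
     omap F \<in> Obj C \<rightarrow>\<^sub>E Obj D \<and> amap F \<in> Arr C \<rightarrow>\<^sub>E Arr D \<and>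
     (\<forall>a b. \<forall>f \<in> Hom C a b. amap F f \<in> Hom D (omap F a) (omap F b)) \<and>
     (\<forall>a \<in> Obj C. amap F (Id C a) = Id D (omap F a)) \<and>
     (\<forall>a b c. \<forall>f \<in> Hom C a b. \<forall>g \<in> Hom C b c.
        amap F (g \<cdot>\<^bsub>C\<^esub> f) = amap F g \<cdot>\<^bsub>D\<^esub> amap F f)"

definition additive_functor ::
    "('o, 'm, 'y) preadditive_category_scheme \<Rightarrow> ('p, 'n, 'z) preadditive_category_scheme
      \<Rightarrow> ('o, 'm, 'p, 'n, 'w) func_scheme \<Rightarrow> bool" where
  "additive_functor C D F \<longleftrightarrow> is_functor C D F \<and>
     (\<forall>a b. \<forall>f \<in> Hom C a b. \<forall>g \<in> Hom C a b.
        amap F (f \<boxplus>\<^bsub>C\<^esub> g) = amap F f \<boxplus>\<^bsub>D\<^esub> amap F g)"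

definition id_func :: "('o, 'm, 'z) category_scheme \<Rightarrow> ('o, 'm, 'o, 'm) func" where
  "id_func C = \<lparr>omap = (\<lambda>a \<in> Obj C. a), amap = (\<lambda>f \<in> Arr C. f)\<rparr>"

definition comp_func ::
    "('o, 'm, 'z) category_scheme \<Rightarrow> ('p, 'n, 'q, 'r, 'v) func_scheme
      \<Rightarrow> ('o, 'm, 'p, 'n, 'w) func_scheme \<Rightarrow> ('o, 'm, 'q, 'r) func" where
  "comp_func C G F =
     \<lparr>omap = compose (Obj C) (omap G) (omap F), amap = compose (Arr C) (amap G) (amap F)\<rparr>"

definition natural_iso ::
    "('o, 'm, 'y) category_scheme \<Rightarrow> ('p, 'n, 'z) category_scheme
      \<Rightarrow> ('o, 'm, 'p, 'n, 'v) func_scheme \<Rightarrow> ('o, 'm, 'p, 'n, 'w) func_scheme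
      \<Rightarrow> ('o \<Rightarrow> 'n) \<Rightarrow> bool" where
  "natural_iso C D F G \<eta> \<longleftrightarrow> \<eta> \<in> Obj C \<rightarrow>\<^sub>E Arr D \<and>
     (\<forall>a \<in> Obj C. \<eta> a \<in> Hom D (omap F a) (omap G a) \<and> is_iso D (\<eta> a)) \<and>
     (\<forall>a b. \<forall>f \<in> Hom C a b. \<eta> b \<cdot>\<^bsub>D\<^esub> amap F f = amap G f \<cdot>\<^bsub>D\<^esub> \<eta> a)"


section \<open>Triangulated categories and exact functors\<close>

text \<open>The suspension is an autoequivalence, with \<open>Unshift\<close> a quasi-inverse; a suspension which
  is an automorphism is the special case of trivial unit and counit. The object and arrow classes
  are HOL sets, so smallness holds by construction.\<close>

record ('o, 'm) triangulated_category = "('o, 'm) preadditive_category" +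
  Shift :: "('o, 'm, 'o, 'm) func"
  Unshift :: "('o, 'm, 'o, 'm) func"
  Tri :: "('m \<times> 'm \<times> 'm) set"

definition candidate_triangle ::
    "('o, 'm, 'z) triangulated_category_scheme \<Rightarrow> 'o \<Rightarrow> 'o \<Rightarrow> 'o \<Rightarrow> 'm \<Rightarrow> 'm \<Rightarrow> 'm \<Rightarrow> bool" where
  "candidate_triangle K x y z f g h \<longleftrightarrow>
     f \<in> Hom K x y \<and> g \<in> Hom K y z \<and> h \<in> Hom K z (omap (Shift K) x)"

definition triangle ::
    "('o, 'm, 'z) triangulated_category_scheme \<Rightarrow> 'o \<Rightarrow> 'o \<Rightarrow> 'o \<Rightarrow> 'm \<Rightarrow> 'm \<Rightarrow> 'm \<Rightarrow> bool" where
  "triangle K x y z f g h \<longleftrightarrow> candidate_triangle K x y z f g h \<and> (f, g, h) \<in> Tri K"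

locale triangulated_category = additive_category K
  for K :: "('o, 'm, 'z) triangulated_category_scheme" (structure) +
  assumes Shift_additive: "additive_functor K K (Shift K)"
    and Unshift_functor: "is_functor K K (Unshift K)"
    and Shift_unit: "\<exists>\<eta>. natural_iso K K (id_func K) (comp_func K (Unshift K) (Shift K)) \<eta>"
    and Shift_counit: "\<exists>\<epsilon>. natural_iso K K (comp_func K (Shift K) (Unshift K)) (id_func K) \<epsilon>"
    and Tri_candidate: "(f, g, h) \<in> Tri K \<Longrightarrow> \<exists>x y z. candidate_triangle K x y z f g h"
    and TR1_iso:
      "\<lbrakk>triangle K x y z f g h; candidate_triangle K x' y' z' f' g' h';
        u \<in> Hom K x x'; v \<in> Hom K y y'; w \<in> Hom K z z';
        is_iso K u; is_iso K v; is_iso K w;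
        v \<cdot> f = f' \<cdot> u; w \<cdot> g = g' \<cdot> v; amap (Shift K) u \<cdot> h = h' \<cdot> w\<rbrakk>
       \<Longrightarrow> triangle K x' y' z' f' g' h'"
    and TR1_Id:
      "\<lbrakk>x \<in> Obj K; zero_object K z\<rbrakk>
       \<Longrightarrow> triangle K x x z (Id K x) (Zero K x z) (Zero K z (omap (Shift K) x))"
    and TR1_cone: "f \<in> Hom K x y \<Longrightarrow> \<exists>z g h. triangle K x y z f g h"
    and TR2:
      "candidate_triangle K x y z f g h \<Longrightarrow>
       triangle K x y z f g h \<longleftrightarrow>
       triangle K y z (omap (Shift K) x) g h (Neg K (amap (Shift K) f))"
    and TR3:
      "\<lbrakk>triangle K x y z f g h; triangle K x' y' z' f' g' h';
        u \<in> Hom K x x'; v \<in> Hom K y y'; v \<cdot> f = f' \<cdot> u\<rbrakk>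
       \<Longrightarrow> \<exists>w \<in> Hom K z z'. w \<cdot> g = g' \<cdot> v \<and> amap (Shift K) u \<cdot> h = h' \<cdot> w"
    and TR4:
      "\<lbrakk>triangle K x y c1 f p1 q1; triangle K y z c3 g p3 q3; triangle K x z c2 (g \<cdot> f) p2 q2\<rbrakk>
       \<Longrightarrow> \<exists>s t. triangle K c1 c2 c3 s t (amap (Shift K) p1 \<cdot> q3) \<and>
             s \<cdot> p1 = p2 \<cdot> g \<and> q2 \<cdot> s = q1 \<and>
             t \<cdot> p2 = p3 \<and> q3 \<cdot> t = amap (Shift K) f \<cdot> q2"

text \<open>\<open>\<Sigma>\<^sup>i x\<close> for an integer \<open>i\<close>.\<close>

definition shift_pow ::
    "('o, 'm, 'z) triangulated_category_scheme \<Rightarrow> int \<Rightarrow> 'o \<Rightarrow> 'o" where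
  "shift_pow K i x =
     (if 0 \<le> i then (omap (Shift K) ^^ nat i) x else (omap (Unshift K) ^^ nat (- i)) x)"

text \<open>An exact functor carries its comparison isomorphism \<open>F \<circ> \<Sigma> \<cong> \<Sigma> \<circ> F\<close>.\<close>

record ('o, 'm, 'p, 'n) exact_func = "('o, 'm, 'p, 'n) func" +
  comparison :: "'o \<Rightarrow> 'n"

definition tcat_hom ::
    "('o, 'm) triangulated_category \<Rightarrow> ('p, 'n) triangulated_category
      \<Rightarrow> ('o, 'm, 'p, 'n) exact_func set" where
  "tcat_hom K L = {F. additive_functor K L F \<and>
     natural_iso K L (comp_func K F (Shift K)) (comp_func K (Shift L) F) (comparison F) \<and>
     (\<forall>x y z f g h. triangle K x y z f g h \<longrightarrow>
        triangle L (omap F x) (omap F y) (omap F z)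
          (amap F f) (amap F g) (comparison F x \<cdot>\<^bsub>L\<^esub> amap F h))}"

definition tcat_id :: "('o, 'm) triangulated_category \<Rightarrow> ('o, 'm, 'o, 'm) exact_func" where
  "tcat_id K = \<lparr>omap = (\<lambda>x \<in> Obj K. x), amap = (\<lambda>f \<in> Arr K. f),
     comparison = (\<lambda>x \<in> Obj K. Id K (omap (Shift K) x))\<rparr>"

definition tcat_comp ::
    "('o, 'm) triangulated_category \<Rightarrow> ('q, 'r) triangulated_category
      \<Rightarrow> ('p, 'n, 'q, 'r) exact_func \<Rightarrow> ('o, 'm, 'p, 'n) exact_func
      \<Rightarrow> ('o, 'm, 'q, 'r) exact_func" where
  "tcat_comp K M G F =
     \<lparr>omap = compose (Obj K) (omap G) (omap F), amap = compose (Arr K) (amap G) (amap F),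
      comparison = (\<lambda>x \<in> Obj K. comparison G (omap F x) \<cdot>\<^bsub>M\<^esub> amap G (comparison F x))\<rparr>"


section \<open>The lattice of thick subcategories\<close>

text \<open>A full subcategory is given by its set of objects. Suspensions are all \<open>\<Sigma>\<^sup>i\<close> with \<open>i\<close>
  an integer, and thick subcategories contain the zero objects.\<close>

definition thick_subcategory ::
    "('o, 'm, 'z) triangulated_category_scheme \<Rightarrow> 'o set \<Rightarrow> bool" where
  "thick_subcategory K M \<longleftrightarrow> M \<subseteq> Obj K \<and>
     (\<forall>z. zero_object K z \<longrightarrow> z \<in> M) \<and>
     (\<forall>x \<in> M. \<forall>y. isomorphic K x y \<longrightarrow> y \<in> M) \<and>
     (\<forall>x \<in> M. \<forall>i. shift_pow K i x \<in> M) \<and>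
     (\<forall>x y z f g h. triangle K x y z f g h \<longrightarrow> x \<in> M \<longrightarrow> y \<in> M \<longrightarrow> z \<in> M) \<and>
     (\<forall>x y s. direct_sum K x y s \<longrightarrow> s \<in> M \<longrightarrow> x \<in> M \<and> y \<in> M)"

definition thick :: "('o, 'm, 'z) triangulated_category_scheme \<Rightarrow> 'o set \<Rightarrow> 'o set" where
  "thick K A = \<Inter> {M. thick_subcategory K M \<and> A \<subseteq> M}"

definition Thick :: "('o, 'm, 'z) triangulated_category_scheme \<Rightarrow> 'o set gorder" where
  "Thick K = \<lparr>carrier = {M. thick_subcategory K M}, eq = (=), le = (\<subseteq>)\<rparr>"

definition Thick_map ::
    "('o, 'm) triangulated_category \<Rightarrow> ('p, 'n) triangulated_category
      \<Rightarrow> ('o, 'm, 'p, 'n) exact_func \<Rightarrow> 'o set \<Rightarrow> 'p set" where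
  "Thick_map K L F = (\<lambda>M \<in> carrier (Thick K). thick L (omap F ` M))"


section \<open>Complete join semilattices and frames\<close>

definition cjslat_hom :: "'a gorder \<Rightarrow> 'b gorder \<Rightarrow> ('a \<Rightarrow> 'b) set" where
  "cjslat_hom L M = {f \<in> carrier L \<rightarrow>\<^sub>E carrier M. isotone L M f \<and> sup_pres L M f}"

definition is_frame :: "'a gorder \<Rightarrow> bool" where
  "is_frame F \<longleftrightarrow> complete_lattice F \<and>
     (\<forall>a \<in> carrier F. \<forall>B \<subseteq> carrier F. a \<sqinter>\<^bsub>F\<^esub> (\<Squnion>\<^bsub>F\<^esub> B) = \<Squnion>\<^bsub>F\<^esub> ((\<lambda>b. a \<sqinter>\<^bsub>F\<^esub> b) ` B))"

definition frame_hom :: "'a gorder \<Rightarrow> 'b gorder \<Rightarrow> ('a \<Rightarrow> 'b) set" where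
  "frame_hom F G = {g \<in> carrier F \<rightarrow>\<^sub>E carrier G.
     sup_pres F G g \<and> meet_pres F G g \<and> g \<top>\<^bsub>F\<^esub> = \<top>\<^bsub>G\<^esub>}"

definition two :: "bool gorder" where
  "two = \<lparr>carrier = UNIV, eq = (=), le = (\<le>)\<rparr>"

definition spatial_frame :: "'a gorder \<Rightarrow> bool" where
  "spatial_frame F \<longleftrightarrow> is_frame F \<and>
     (\<forall>a \<in> carrier F. \<forall>b \<in> carrier F. \<not> a \<sqsubseteq>\<^bsub>F\<^esub> b \<longrightarrow> (\<exists>p \<in> frame_hom F two. p a \<and> \<not> p b))"

definition opens_frame :: "'a topology \<Rightarrow> 'a set gorder" where
  "opens_frame X = \<lparr>carrier = {U. openin X U}, eq = (=), le = (\<subseteq>)\<rparr>"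


section \<open>Sober spaces and the functor \<open>pt\<close>\<close>

definition sober_space :: "'a topology \<Rightarrow> bool" where
  "sober_space X \<longleftrightarrow>
     (\<forall>C. closedin X C \<and> C \<noteq> {} \<and>
          (\<forall>A B. closedin X A \<and> closedin X B \<and> C \<subseteq> A \<union> B \<longrightarrow> C \<subseteq> A \<or> C \<subseteq> B)
        \<longrightarrow> (\<exists>!x. x \<in> topspace X \<and> X closure_of {x} = C))"

definition sob_hom :: "'a topology \<Rightarrow> 'b topology \<Rightarrow> ('a \<Rightarrow> 'b) set" where
  "sob_hom X Y = {f \<in> topspace X \<rightarrow>\<^sub>E topspace Y. continuous_map X Y f}"

definition pt_open :: "'a gorder \<Rightarrow> 'a \<Rightarrow> ('a \<Rightarrow> bool) set" where
  "pt_open F l = {p \<in> frame_hom F two. p l}"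

definition pt :: "'a gorder \<Rightarrow> ('a \<Rightarrow> bool) topology" where
  "pt F = topology (\<lambda>U. \<exists>l \<in> carrier F. U = pt_open F l)"

definition pt_map :: "'a gorder \<Rightarrow> 'b gorder \<Rightarrow> ('a \<Rightarrow> 'b) \<Rightarrow> ('b \<Rightarrow> bool) \<Rightarrow> 'a \<Rightarrow> bool" where
  "pt_map F G g = (\<lambda>p \<in> frame_hom G two. compose (carrier F) p g)"


section \<open>The left adjoint \<open>d\<close> of the forgetful functor from spatial frames\<close>

text \<open>The left adjoint is realised as the frame of opens of the space of points
  \<open>CjSLat(L, 2)\<close>, with the sets \<open>{p. p l}\<close> as a subbasis; the theorem \<open>d_universal\<close> below shows
  that it has the defining universal property. The full set has to be added to the generating
  family: the zero map \<open>L \<rightarrow> 2\<close> lies in no \<open>{p. p l}\<close>. The action on morphisms is the one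
  determined by the universal property.\<close>

definition d_basic :: "'a gorder \<Rightarrow> 'a \<Rightarrow> ('a \<Rightarrow> bool) set" where
  "d_basic L l = {p \<in> cjslat_hom L two. p l}"

definition d_space :: "'a gorder \<Rightarrow> ('a \<Rightarrow> bool) topology" where
  "d_space L = topology_generated_by (insert (cjslat_hom L two) (d_basic L ` carrier L))"

definition d_frame :: "'a gorder \<Rightarrow> ('a \<Rightarrow> bool) set gorder" where
  "d_frame L = opens_frame (d_space L)"

definition d_unit :: "'a gorder \<Rightarrow> 'a \<Rightarrow> ('a \<Rightarrow> bool) set" where
  "d_unit L = (\<lambda>l \<in> carrier L. d_basic L l)"

definition d_transpose ::
    "'a gorder \<Rightarrow> 'b gorder \<Rightarrow> ('a \<Rightarrow> 'b) \<Rightarrow> ('a \<Rightarrow> bool) set \<Rightarrow> 'b" where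
  "d_transpose L F f =
     (THE g. g \<in> frame_hom (d_frame L) F \<and> compose (carrier L) g (d_unit L) = f)"

definition d_map ::
    "'a gorder \<Rightarrow> 'b gorder \<Rightarrow> ('a \<Rightarrow> 'b) \<Rightarrow> ('a \<Rightarrow> bool) set \<Rightarrow> ('b \<Rightarrow> bool) set" where
  "d_map L M f = d_transpose L (d_frame M) (compose (carrier L) (d_unit M) f)"


section \<open>The space \<open>fSpcnt\<close>, supports and support data\<close>

definition fSpcnt ::
    "('o, 'm) triangulated_category \<Rightarrow> (('o set \<Rightarrow> bool) set \<Rightarrow> bool) topology" where
  "fSpcnt K = pt (d_frame (Thick K))"

definition fSpcnt_map ::
    "('o, 'm) triangulated_category \<Rightarrow> ('p, 'n) triangulated_category
      \<Rightarrow> ('o, 'm, 'p, 'n) exact_func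
      \<Rightarrow> (('p set \<Rightarrow> bool) set \<Rightarrow> bool) \<Rightarrow> ('o set \<Rightarrow> bool) set \<Rightarrow> bool" where
  "fSpcnt_map K L F =
     pt_map (d_frame (Thick K)) (d_frame (Thick L)) (d_map (Thick K) (Thick L) (Thick_map K L F))"

text \<open>\<open>pt_open\<close> is the isomorphism from a spatial frame to the opens of its space of points,
  see \<open>pt_open_iso\<close>.\<close>

definition supp ::
    "('o, 'm) triangulated_category \<Rightarrow> 'o \<Rightarrow> (('o set \<Rightarrow> bool) set \<Rightarrow> bool) set" where
  "supp K x = pt_open (d_frame (Thick K)) (d_unit (Thick K) (thick K {x}))"

definition support_datum ::
    "('o, 'm) triangulated_category \<Rightarrow> 'x topology \<Rightarrow> ('o \<Rightarrow> 'x set) \<Rightarrow> bool" where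
  "support_datum K X \<sigma> \<longleftrightarrow>
     (\<forall>x \<in> Obj K. openin X (\<sigma> x)) \<and>
     (\<forall>z. zero_object K z \<longrightarrow> \<sigma> z = {}) \<and>
     (\<forall>x \<in> Obj K. \<forall>i. \<sigma> (shift_pow K i x) = \<sigma> x) \<and>
     (\<forall>x y s. direct_sum K x y s \<longrightarrow> \<sigma> s = \<sigma> x \<union> \<sigma> y) \<and>
     (\<forall>x y z f g h. triangle K x y z f g h \<longrightarrow> \<sigma> y \<subseteq> \<sigma> x \<union> \<sigma> z)"

section \<open>The universal property of \<open>d\<close> and Stone duality\<close>

lemma opens_frame_simps [simp]:
  "carrier (opens_frame X) = {U. openin X U}"
  "(U \<sqsubseteq>\<^bsub>opens_frame X\<^esub> V) = (U \<subseteq> V)"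
  by (simp_all add: opens_frame_def)

lemma partial_order_opens_frame: "partial_order (opens_frame X)"
  by unfold_locales (auto simp: opens_frame_def)

lemma opens_frame_least:
  assumes "A \<subseteq> {U. openin X U}"
  shows "least (opens_frame X) (\<Union>A) (Upper (opens_frame X) A)"
  using assms unfolding least_def Upper_def by (auto intro!: openin_Union)

lemma opens_frame_greatest:
  assumes "A \<subseteq> {U. openin X U}"
  shows "greatest (opens_frame X) (\<Union>{U. openin X U \<and> (\<forall>V\<in>A. U \<subseteq> V)}) (Lower (opens_frame X) A)"
  using assms unfolding greatest_def Lower_def by (auto intro!: openin_Union)

lemma complete_lattice_opens_frame: "complete_lattice (opens_frame X)"
proof -
  interpret partial_order "opens_frame X" by (rule partial_order_opens_frame)
  show ?thesis
  proof unfold_locales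
    fix A assume "A \<subseteq> carrier (opens_frame X)"
    then have A: "A \<subseteq> {U. openin X U}" by simp
    show "\<exists>s. least (opens_frame X) s (Upper (opens_frame X) A)"
      using opens_frame_least[OF A] by (rule exI)
    show "\<exists>s. greatest (opens_frame X) s (Lower (opens_frame X) A)"
      using opens_frame_greatest[OF A] by (rule exI)
  qed
qed

lemma opens_frame_sup:
  assumes "A \<subseteq> {U. openin X U}"
  shows "\<Squnion>\<^bsub>opens_frame X\<^esub> A = \<Union>A"
proof -
  interpret complete_lattice "opens_frame X" by (rule complete_lattice_opens_frame)
  show ?thesis
    using assms by (intro least_unique[OF sup_lub opens_frame_least]) auto
qed

lemma opens_frame_meet:
  assumes "openin X U" "openin X V"
  shows "U \<sqinter>\<^bsub>opens_frame X\<^esub> V = U \<inter> V"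
proof -
  interpret complete_lattice "opens_frame X" by (rule complete_lattice_opens_frame)
  have "greatest (opens_frame X) (U \<inter> V) (Lower (opens_frame X) {U, V})"
    using assms unfolding greatest_def Lower_def by auto
  then show ?thesis
    unfolding meet_def using assms by (intro greatest_unique[OF inf_glb]) auto
qed

lemma opens_frame_top: "\<top>\<^bsub>opens_frame X\<^esub> = topspace X"
proof -
  interpret complete_lattice "opens_frame X" by (rule complete_lattice_opens_frame)
  have "greatest (opens_frame X) (topspace X) (carrier (opens_frame X))"
    unfolding greatest_def by (auto dest: openin_subset)
  then show ?thesis
    by (rule greatest_unique[OF top_greatest])
qed

lemma is_frame_opens_frame: "is_frame (opens_frame X)"
proof -
  have "U \<sqinter>\<^bsub>opens_frame X\<^esub> (\<Squnion>\<^bsub>opens_frame X\<^esub> B) =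
        \<Squnion>\<^bsub>opens_frame X\<^esub> ((\<lambda>b. U \<sqinter>\<^bsub>opens_frame X\<^esub> b) ` B)"
    if U: "openin X U" and B: "B \<subseteq> {U. openin X U}" for U B
  proof -
    have "(\<lambda>b. U \<sqinter>\<^bsub>opens_frame X\<^esub> b) ` B = (\<lambda>b. U \<inter> b) ` B"
      using U B by (auto simp: opens_frame_meet image_iff subset_iff)
    moreover have "(\<lambda>b. U \<inter> b) ` B \<subseteq> {U. openin X U}"
      using U B by auto
    ultimately show ?thesis
      using U B by (auto simp: opens_frame_sup opens_frame_meet openin_Union subset_iff)
  qed
  then show ?thesis
    by (simp add: is_frame_def complete_lattice_opens_frame)
qed

lemma two_simps [simp]: "carrier two = UNIV" "(p \<sqsubseteq>\<^bsub>two\<^esub> q) = (p \<le> q)"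
  by (simp_all add: two_def)

lemma partial_order_two: "partial_order two"
  by unfold_locales (auto simp: two_def)

lemma two_least: "least two (True \<in> A) (Upper two A)"
  unfolding least_def Upper_def by auto

lemma two_greatest: "greatest two (False \<notin> A) (Lower two A)"
  unfolding greatest_def Lower_def by auto (metis (full_types))

lemma complete_lattice_two: "complete_lattice two"
proof -
  interpret partial_order two by (rule partial_order_two)
  show ?thesis
  proof unfold_locales
    fix A
    show "\<exists>s. least two s (Upper two A)"
      using two_least by (rule exI)
    show "\<exists>s. greatest two s (Lower two A)"
      using two_greatest by (rule exI)
  qed
qed

lemma two_sup: "\<Squnion>\<^bsub>two\<^esub> A = (True \<in> A)"
proof -
  interpret complete_lattice two by (rule complete_lattice_two)
  show ?thesis
    by (intro least_unique[OF sup_lub two_least]) auto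
qed

lemma two_meet: "p \<sqinter>\<^bsub>two\<^esub> q = (p \<and> q)"
proof -
  interpret complete_lattice two by (rule complete_lattice_two)
  show ?thesis
    using greatest_unique[OF inf_glb two_greatest, of "{p, q}"] unfolding meet_def by auto
qed

lemma two_top: "\<top>\<^bsub>two\<^esub> = True"
proof -
  interpret complete_lattice two by (rule complete_lattice_two)
  have "greatest two True (carrier two)"
    unfolding greatest_def by auto
  then show ?thesis
    by (rule greatest_unique[OF top_greatest])
qed

lemma frame_hom_two_iff:
  "p \<in> frame_hom F two \<longleftrightarrow> complete_lattice F \<and> p \<in> extensional (carrier F) \<and>
     (\<forall>A \<subseteq> carrier F. p (\<Squnion>\<^bsub>F\<^esub> A) = (\<exists>a \<in> A. p a)) \<and>
     (\<forall>a \<in> carrier F. \<forall>b \<in> carrier F. p (a \<sqinter>\<^bsub>F\<^esub> b) = (p a \<and> p b)) \<and> p \<top>\<^bsub>F\<^esub>"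
  by (auto simp: frame_hom_def sup_pres_def meet_pres_def complete_lattice_two two_sup two_meet
      two_top PiE_def image_iff)

lemma frame_hom_two_sup:
  "\<lbrakk>p \<in> frame_hom F two; A \<subseteq> carrier F\<rbrakk> \<Longrightarrow> p (\<Squnion>\<^bsub>F\<^esub> A) \<longleftrightarrow> (\<exists>a \<in> A. p a)"
  by (simp add: frame_hom_two_iff)

lemma frame_hom_two_meet:
  "\<lbrakk>p \<in> frame_hom F two; a \<in> carrier F; b \<in> carrier F\<rbrakk> \<Longrightarrow> p (a \<sqinter>\<^bsub>F\<^esub> b) \<longleftrightarrow> p a \<and> p b"
  by (simp add: frame_hom_two_iff)

lemma frame_hom_two_top: "p \<in> frame_hom F two \<Longrightarrow> p \<top>\<^bsub>F\<^esub>"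
  by (simp add: frame_hom_two_iff)

lemma cjslat_hom_two_iff:
  "p \<in> cjslat_hom L two \<longleftrightarrow> complete_lattice L \<and> p \<in> extensional (carrier L) \<and>
     (\<forall>A \<subseteq> carrier L. p (\<Squnion>\<^bsub>L\<^esub> A) = (\<exists>a \<in> A. p a))" (is "?l = ?r")
proof
  assume ?l
  then show ?r
    by (auto simp: cjslat_hom_def sup_pres_def two_sup PiE_def image_iff)
next
  assume r: ?r
  then interpret complete_lattice L by simp
  have "p y" if xy: "x \<in> carrier L" "y \<in> carrier L" "x \<sqsubseteq>\<^bsub>L\<^esub> y" "p x" for x y
  proof -
    have "x \<squnion>\<^bsub>L\<^esub> y = y"
      using xy by (simp add: le_iff_meet)
    then have "\<Squnion>\<^bsub>L\<^esub> {x, y} = y"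
      by (simp add: join_def)
    then show ?thesis
      using r xy by (metis empty_subsetI insertI1 insert_subset)
  qed
  then have "isotone L two p"
    unfolding isotone_def
    using weak_partial_order_axioms partial_order_two partial_order.axioms(1) by auto
  then show ?l
    using r complete_lattice_axioms
    by (auto simp: cjslat_hom_def sup_pres_def two_sup PiE_def image_iff complete_lattice_two)
qed

lemma spatial_frame_opens_frame: "spatial_frame (opens_frame X)"
proof -
  have "\<exists>p \<in> frame_hom (opens_frame X) two. p U \<and> \<not> p V"
    if U: "openin X U" and V: "openin X V" and "\<not> U \<subseteq> V" for U V
  proof -
    obtain x where x: "x \<in> U" "x \<notin> V"
      using \<open>\<not> U \<subseteq> V\<close> by blast
    define p where "p = (\<lambda>W \<in> carrier (opens_frame X). x \<in> W)"
    have p: "p W \<longleftrightarrow> x \<in> W" if "openin X W" for W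
      using that by (simp add: p_def)
    have "p (\<Squnion>\<^bsub>opens_frame X\<^esub> A) \<longleftrightarrow> (\<exists>W \<in> A. p W)" if A: "A \<subseteq> {W. openin X W}" for A
    proof -
      have "openin X (\<Union>A)"
        using A by (intro openin_Union) auto
      then have "p (\<Squnion>\<^bsub>opens_frame X\<^esub> A) \<longleftrightarrow> (\<exists>W \<in> A. x \<in> W)"
        using opens_frame_sup[OF A] p by simp
      also have "\<dots> \<longleftrightarrow> (\<exists>W \<in> A. p W)"
        using A p by (intro bex_cong) auto
      finally show ?thesis .
    qed
    moreover have "p (W \<sqinter>\<^bsub>opens_frame X\<^esub> W') \<longleftrightarrow> p W \<and> p W'"
      if "openin X W" "openin X W'" for W W'
      using that p by (simp add: opens_frame_meet openin_Int)
    moreover have "p \<top>\<^bsub>opens_frame X\<^esub>"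
      using x(1) openin_subset[OF U] p[OF openin_topspace] by (auto simp: opens_frame_top)
    ultimately have "p \<in> frame_hom (opens_frame X) two"
      unfolding frame_hom_two_iff by (simp add: complete_lattice_opens_frame p_def[abs_def])
    moreover have "p U" "\<not> p V"
      using x p U V by simp_all
    ultimately show ?thesis
      by blast
  qed
  then show ?thesis
    by (simp add: spatial_frame_def is_frame_opens_frame)
qed

lemma openin_pt_iff:
  assumes "is_frame F"
  shows "openin (pt F) U \<longleftrightarrow> (\<exists>l \<in> carrier F. U = pt_open F l)"
proof -
  interpret complete_lattice F using assms by (simp add: is_frame_def)
  have "istopology (\<lambda>U. \<exists>l \<in> carrier F. U = pt_open F l)"
    unfolding istopology_def
  proof (intro conjI allI impI)
    fix S T assume "\<exists>l \<in> carrier F. S = pt_open F l" "\<exists>l \<in> carrier F. T = pt_open F l"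
    then obtain l m where lm: "l \<in> carrier F" "m \<in> carrier F" "S = pt_open F l" "T = pt_open F m"
      by auto
    then have "S \<inter> T = pt_open F (l \<sqinter>\<^bsub>F\<^esub> m)"
      by (auto simp: pt_open_def frame_hom_two_sup frame_hom_two_meet frame_hom_two_top)
    then show "\<exists>l \<in> carrier F. S \<inter> T = pt_open F l"
      using lm meet_closed by blast
  next
    fix \<K> assume "\<forall>K\<in>\<K>. \<exists>l \<in> carrier F. K = pt_open F l"
    then obtain h where h: "\<And>K. K \<in> \<K> \<Longrightarrow> h K \<in> carrier F \<and> K = pt_open F (h K)"
      by metis
    then have sub: "h ` \<K> \<subseteq> carrier F" by auto
    have "p \<in> \<Union>\<K> \<longleftrightarrow> p \<in> pt_open F (\<Squnion>\<^bsub>F\<^esub> (h ` \<K>))" for p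
    proof -
      have "p \<in> \<Union>\<K> \<longleftrightarrow> (\<exists>K\<in>\<K>. p \<in> pt_open F (h K))"
        using h by blast
      also have "\<dots> \<longleftrightarrow> p \<in> pt_open F (\<Squnion>\<^bsub>F\<^esub> (h ` \<K>))"
        using sub by (auto simp: pt_open_def frame_hom_two_sup frame_hom_two_meet frame_hom_two_top)
      finally show ?thesis .
    qed
    then have "\<Union>\<K> = pt_open F (\<Squnion>\<^bsub>F\<^esub> (h ` \<K>))"
      by blast
    then show "\<exists>l \<in> carrier F. \<Union>\<K> = pt_open F l"
      using sub sup_closed by blast
  qed
  then show ?thesis
    by (simp add: pt_def topology_inverse')
qed

lemma topspace_pt:
  assumes "is_frame F"
  shows "topspace (pt F) = frame_hom F two"
proof
  interpret complete_lattice F using assms by (simp add: is_frame_def)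
  show "topspace (pt F) \<subseteq> frame_hom F two"
    using openin_topspace[of "pt F"] unfolding openin_pt_iff[OF assms] pt_open_def by auto
  have "frame_hom F two = pt_open F \<top>\<^bsub>F\<^esub>"
    by (auto simp: pt_open_def frame_hom_two_sup frame_hom_two_meet frame_hom_two_top)
  then have "openin (pt F) (frame_hom F two)"
    using openin_pt_iff[OF assms] top_closed by blast
  then show "frame_hom F two \<subseteq> topspace (pt F)"
    by (rule openin_subset)
qed

theorem pt_open_iso:
  assumes "spatial_frame F"
  shows "bij_betw (pt_open F) (carrier F) {U. openin (pt F) U}"
    and "\<lbrakk>a \<in> carrier F; b \<in> carrier F\<rbrakk> \<Longrightarrow> pt_open F a \<subseteq> pt_open F b \<longleftrightarrow> a \<sqsubseteq>\<^bsub>F\<^esub> b"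
proof -
  have F: "is_frame F" using assms by (simp add: spatial_frame_def)
  interpret complete_lattice F using F by (simp add: is_frame_def)
  have le: "pt_open F a \<subseteq> pt_open F b \<longleftrightarrow> a \<sqsubseteq>\<^bsub>F\<^esub> b"
    if ab: "a \<in> carrier F" "b \<in> carrier F" for a b
  proof
    assume "pt_open F a \<subseteq> pt_open F b"
    then show "a \<sqsubseteq>\<^bsub>F\<^esub> b"
      using assms ab unfolding spatial_frame_def pt_open_def by blast
  next
    assume "a \<sqsubseteq>\<^bsub>F\<^esub> b"
    then have "a \<sqinter>\<^bsub>F\<^esub> b = a"
      using ab by (simp add: le_iff_join)
    then have "q b" if "q \<in> frame_hom F two" "q a" for q
      using that frame_hom_two_meet[OF that(1) ab] by simp
    then show "pt_open F a \<subseteq> pt_open F b"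
      by (auto simp: pt_open_def)
  qed
  then show "\<lbrakk>a \<in> carrier F; b \<in> carrier F\<rbrakk> \<Longrightarrow> pt_open F a \<subseteq> pt_open F b \<longleftrightarrow> a \<sqsubseteq>\<^bsub>F\<^esub> b"
    .
  have "inj_on (pt_open F) (carrier F)"
    using le by (intro inj_onI) (metis le_antisym subset_refl)
  moreover have "pt_open F ` carrier F = {U. openin (pt F) U}"
    by (auto simp: openin_pt_iff[OF F])
  ultimately show "bij_betw (pt_open F) (carrier F) {U. openin (pt F) U}"
    by (simp add: bij_betw_def)
qed

lemma topspace_d_space: "topspace (d_space L) = cjslat_hom L two"
proof -
  have "\<Union>(d_basic L ` carrier L) \<subseteq> cjslat_hom L two"
    by (auto simp: d_basic_def)
  then show ?thesis
    unfolding d_space_def topology_generated_by_topspace Union_insert by (rule Un_absorb2)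
qed

lemma openin_d_basic: "l \<in> carrier L \<Longrightarrow> openin (d_space L) (d_basic L l)"
  unfolding d_space_def by (intro topology_generated_by_Basis insertI2 imageI)

lemma spatial_frame_d_frame: "spatial_frame (d_frame L)"
  by (simp add: d_frame_def spatial_frame_opens_frame)

theorem d_unit_in_hom:
  assumes "complete_lattice L"
  shows "d_unit L \<in> cjslat_hom L (d_frame L)"
proof -
  interpret complete_lattice L by fact
  interpret D: complete_lattice "d_frame L"
    by (simp add: d_frame_def complete_lattice_opens_frame)
  have sup: "d_unit L (\<Squnion>\<^bsub>L\<^esub> A) = \<Squnion>\<^bsub>d_frame L\<^esub> (d_unit L ` A)" if A: "A \<subseteq> carrier L" for A
  proof -
    have im: "d_unit L ` A = d_basic L ` A"
      by (rule image_cong) (use A in \<open>auto simp: d_unit_def\<close>)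
    have sub: "d_basic L ` A \<subseteq> {U. openin (d_space L) U}"
      using A by (auto intro!: openin_d_basic)
    have "d_unit L (\<Squnion>\<^bsub>L\<^esub> A) = d_basic L (\<Squnion>\<^bsub>L\<^esub> A)"
      using A by (simp add: d_unit_def)
    also have "\<dots> = \<Union>(d_basic L ` A)"
    proof -
      have "p (\<Squnion>\<^bsub>L\<^esub> A) \<longleftrightarrow> (\<exists>a\<in>A. p a)" if "p \<in> cjslat_hom L two" for p
        using that A by (simp add: cjslat_hom_two_iff)
      then show ?thesis
        by (auto simp: d_basic_def)
    qed
    finally show ?thesis
      using opens_frame_sup[OF sub] by (simp add: im d_frame_def)
  qed
  have "d_unit L x \<subseteq> d_unit L y" if xy: "x \<in> carrier L" "y \<in> carrier L" "x \<sqsubseteq>\<^bsub>L\<^esub> y" for x y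
    using xy unfolding d_unit_def d_basic_def cjslat_hom_def isotone_def by auto
  then have "isotone L (d_frame L) (d_unit L)"
    unfolding isotone_def
    using weak_partial_order_axioms D.weak_partial_order_axioms by (auto simp: d_frame_def)
  then show ?thesis
    using sup complete_lattice_axioms D.complete_lattice_axioms
    by (auto simp: cjslat_hom_def sup_pres_def d_unit_def d_frame_def openin_d_basic)
qed

lemma spatial_frame_eqI:
  assumes "spatial_frame F" "a \<in> carrier F" "b \<in> carrier F"
    and "\<And>q. q \<in> frame_hom F two \<Longrightarrow> q a = q b"
  shows "a = b"
proof -
  have "pt_open F a = pt_open F b"
    using assms(4) by (auto simp: pt_open_def)
  then show ?thesis
    using pt_open_iso(1)[OF assms(1)] assms(2,3) by (auto simp: bij_betw_def dest: inj_onD)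
qed

text \<open>\<open>d_frame L\<close> and \<open>d_unit L\<close> give a universal arrow from every complete lattice to the forgetful
  functor from spatial frames to complete lattices.\<close>

theorem d_universal:
  assumes L: "complete_lattice L" and F: "spatial_frame F" and f: "f \<in> cjslat_hom L F"
  shows "\<exists>!g. g \<in> frame_hom (d_frame L) F \<and> compose (carrier L) g (d_unit L) = f"
proof -
  interpret L: complete_lattice L by fact
  have "complete_lattice F" using F by (simp add: spatial_frame_def is_frame_def)
  then interpret F: complete_lattice F .
  let ?D = "opens_frame (d_space L)"
  have clD: "complete_lattice ?D" by (rule complete_lattice_opens_frame)
  have fL: "f l \<in> carrier F" if "l \<in> carrier L" for l
    using f that by (auto simp: cjslat_hom_def)
  have fsup: "f (\<Squnion>\<^bsub>L\<^esub> A) = \<Squnion>\<^bsub>F\<^esub> (f ` A)" if "A \<subseteq> carrier L" for A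
    using f that by (auto simp: cjslat_hom_def sup_pres_def)
  define r where "r q = compose (carrier L) q f" for q :: "'b \<Rightarrow> bool"
  have r: "r q \<in> cjslat_hom L two" if q: "q \<in> frame_hom F two" for q
  proof -
    have "r q (\<Squnion>\<^bsub>L\<^esub> A) = (\<exists>a\<in>A. r q a)" if A: "A \<subseteq> carrier L" for A
    proof -
      have "r q (\<Squnion>\<^bsub>L\<^esub> A) = q (\<Squnion>\<^bsub>F\<^esub> (f ` A))"
        using A by (simp add: r_def compose_eq fsup)
      also have "\<dots> = (\<exists>a\<in>A. q (f a))"
      proof -
        have "f ` A \<subseteq> carrier F" using A fL by auto
        then show ?thesis using frame_hom_two_sup[OF q] by simp
      qed
      also have "\<dots> = (\<exists>a\<in>A. r q a)"
        using A by (auto simp: r_def compose_eq subset_iff)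
      finally show ?thesis .
    qed
    then show ?thesis
      using L by (auto simp: cjslat_hom_two_iff r_def compose_def)
  qed
  define R where "R U a \<longleftrightarrow> a \<in> carrier F \<and> (\<forall>q \<in> frame_hom F two. q a \<longleftrightarrow> r q \<in> U)" for U a
  have Rb: "R (d_basic L l) (f l)" if l: "l \<in> carrier L" for l
    unfolding R_def d_basic_def
  proof (intro conjI ballI)
    show "f l \<in> carrier F" using l by (rule fL)
    fix q assume q: "q \<in> frame_hom F two"
    have "r q l = q (f l)" using l by (simp add: r_def compose_eq)
    then show "q (f l) \<longleftrightarrow> r q \<in> {p \<in> cjslat_hom L two. p l}"
      using r[OF q] by simp
  qed
  have R_ex: "\<exists>a. R U a" if "openin (d_space L) U" for U
  proof -
    have "generate_topology_on (insert (cjslat_hom L two) (d_basic L ` carrier L)) U"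
      using that by (simp add: d_space_def openin_topology_generated_by_iff)
    then show ?thesis
    proof induction
      case Empty
      have "R {} (\<Squnion>\<^bsub>F\<^esub> {})"
        by (auto simp: R_def frame_hom_two_sup frame_hom_two_meet frame_hom_two_top)
      then show ?case ..
    next
      case (Int U V)
      then obtain a b where "R U a" "R V b" by blast
      then have "R (U \<inter> V) (a \<sqinter>\<^bsub>F\<^esub> b)"
        by (auto simp: R_def frame_hom_two_sup frame_hom_two_meet frame_hom_two_top)
      then show ?case ..
    next
      case (UN K)
      then obtain h where h: "\<And>k. k \<in> K \<Longrightarrow> R k (h k)" by metis
      then have sub: "h ` K \<subseteq> carrier F" by (auto simp: R_def)
      have "q (\<Squnion>\<^bsub>F\<^esub> (h ` K)) \<longleftrightarrow> r q \<in> \<Union>K" if q: "q \<in> frame_hom F two" for q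
      proof -
        have "q (\<Squnion>\<^bsub>F\<^esub> (h ` K)) = (\<exists>k\<in>K. q (h k))"
          using q sub by (auto simp: frame_hom_two_sup frame_hom_two_meet frame_hom_two_top)
        also have "\<dots> \<longleftrightarrow> r q \<in> \<Union>K"
          using h q by (auto simp: R_def)
        finally show ?thesis .
      qed
      then have "R (\<Union>K) (\<Squnion>\<^bsub>F\<^esub> (h ` K))"
        using sub by (auto simp: R_def)
      then show ?case ..
    next
      case (Basis s)
      then consider "s = cjslat_hom L two" | l where "l \<in> carrier L" "s = d_basic L l" by auto
      then show ?case
      proof cases
        case 1
        then have "R s \<top>\<^bsub>F\<^esub>" using r by (auto simp: R_def frame_hom_two_sup frame_hom_two_meet frame_hom_two_top)
        then show ?thesis ..
      next
        case 2
        then have "R s (f l)"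
          using Rb by simp
        then show ?thesis ..
      qed
    qed
  qed
  have R_unique: "a = b" if "R U a" "R U b" for U a b
  proof (rule spatial_frame_eqI[OF F])
    show "a \<in> carrier F" "b \<in> carrier F" using that by (simp_all add: R_def)
    show "q a = q b" if "q \<in> frame_hom F two" for q
    proof -
      have "q a \<longleftrightarrow> r q \<in> U" "q b \<longleftrightarrow> r q \<in> U"
        using \<open>R U a\<close> \<open>R U b\<close> that unfolding R_def by blast+
      then show ?thesis by simp
    qed
  qed
  define g where "g = (\<lambda>U \<in> carrier ?D. THE a. R U a)"
  have Rg: "R U (g U)" if U: "openin (d_space L) U" for U
  proof -
    obtain a where a: "R U a" using R_ex[OF U] by blast
    have "(THE a. R U a) = a"
      by (rule the_equality[where P = "R U", OF a]) (rule R_unique[OF _ a])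
    then show ?thesis using a U by (simp add: g_def)
  qed
  have g_eq: "g U = a" if "openin (d_space L) U" "R U a" for U a
    by (rule R_unique[OF Rg[OF that(1)] that(2)])
  have gF: "g U \<in> carrier F" if "openin (d_space L) U" for U
    using Rg[OF that] by (simp add: R_def)
  have gsup: "g (\<Squnion>\<^bsub>?D\<^esub> A) = \<Squnion>\<^bsub>F\<^esub> (g ` A)" if A: "A \<subseteq> carrier ?D" for A
  proof -
    have sub: "g ` A \<subseteq> carrier F" using A gF by auto
    have "q (\<Squnion>\<^bsub>F\<^esub> (g ` A)) \<longleftrightarrow> r q \<in> \<Union>A" if q: "q \<in> frame_hom F two" for q
    proof -
      have "q (\<Squnion>\<^bsub>F\<^esub> (g ` A)) = (\<exists>k\<in>A. q (g k))"
        using q sub by (auto simp: frame_hom_two_sup frame_hom_two_meet frame_hom_two_top)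
      also have "\<dots> \<longleftrightarrow> r q \<in> \<Union>A"
        using Rg q A by (auto simp: R_def subset_iff)
      finally show ?thesis .
    qed
    then have "R (\<Union>A) (\<Squnion>\<^bsub>F\<^esub> (g ` A))"
      using sub by (auto simp: R_def)
    then show ?thesis
      using A by (auto simp: opens_frame_sup openin_Union subset_iff intro!: g_eq)
  qed
  have gmeet: "g (U \<sqinter>\<^bsub>?D\<^esub> V) = g U \<sqinter>\<^bsub>F\<^esub> g V"
    if UV: "openin (d_space L) U" "openin (d_space L) V" for U V
  proof -
    have "R (U \<inter> V) (g U \<sqinter>\<^bsub>F\<^esub> g V)"
      using Rg[OF UV(1)] Rg[OF UV(2)] by (auto simp: R_def frame_hom_two_sup frame_hom_two_meet frame_hom_two_top)
    then show ?thesis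
      using UV by (auto simp: opens_frame_meet intro!: g_eq)
  qed
  have "R (topspace (d_space L)) \<top>\<^bsub>F\<^esub>"
    using r by (auto simp: R_def frame_hom_two_sup frame_hom_two_meet frame_hom_two_top topspace_d_space)
  then have gtop: "g \<top>\<^bsub>?D\<^esub> = \<top>\<^bsub>F\<^esub>"
    by (auto simp: opens_frame_top intro!: g_eq)
  have g_hom: "g \<in> frame_hom (d_frame L) F"
    using gsup gmeet gtop gF clD F.complete_lattice_axioms F.lattice_axioms
      complete_lattice_lattice[OF clD]
    by (auto simp: frame_hom_def d_frame_def sup_pres_def meet_pres_def g_def PiE_def)
  have g_f: "compose (carrier L) g (d_unit L) = f"
  proof (rule extensionalityI)
    show "compose (carrier L) g (d_unit L) \<in> extensional (carrier L)"
      by (rule compose_extensional)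
    show "f \<in> extensional (carrier L)"
      using f by (auto simp: cjslat_hom_def PiE_def)
    show "compose (carrier L) g (d_unit L) l = f l" if "l \<in> carrier L" for l
      using g_eq[OF openin_d_basic Rb] that by (simp add: compose_eq d_unit_def)
  qed
  show ?thesis
  proof (rule ex1I[of _ g])
    show "g \<in> frame_hom (d_frame L) F \<and> compose (carrier L) g (d_unit L) = f"
      using g_hom g_f by simp
    fix g' assume g': "g' \<in> frame_hom (d_frame L) F \<and> compose (carrier L) g' (d_unit L) = f"
    have sup': "g' (\<Squnion>\<^bsub>?D\<^esub> A) = \<Squnion>\<^bsub>F\<^esub> (g' ` A)" if "A \<subseteq> carrier ?D" for A
      using g' that by (auto simp: frame_hom_def sup_pres_def d_frame_def)
    have meet': "g' (U \<sqinter>\<^bsub>?D\<^esub> V) = g' U \<sqinter>\<^bsub>F\<^esub> g' V"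
      if "openin (d_space L) U" "openin (d_space L) V" for U V
      using g' that by (auto simp: frame_hom_def meet_pres_def d_frame_def)
    have top': "g' \<top>\<^bsub>?D\<^esub> = \<top>\<^bsub>F\<^esub>"
      using g' by (auto simp: frame_hom_def d_frame_def)
    have eq: "openin (d_space L) U \<and> g' U = g U"
      if "generate_topology_on (insert (cjslat_hom L two) (d_basic L ` carrier L)) U" for U
      using that
    proof induction
      case Empty
      have "g' (\<Squnion>\<^bsub>?D\<^esub> {}) = g (\<Squnion>\<^bsub>?D\<^esub> {})"
        using gsup[of "{}"] sup'[of "{}"] by simp
      then show ?case
        by (simp add: opens_frame_sup)
    next
      case (Int U V)
      then show ?case
        using gmeet[of U V] meet'[of U V] by (simp add: opens_frame_meet openin_Int)
    next
      case (UN K)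
      then have K: "K \<subseteq> {U. openin (d_space L) U}" and im: "g' ` K = g ` K"
        by (auto simp: image_iff)
      then show ?case
        using gsup[of K] sup'[of K] by (simp add: opens_frame_sup openin_Union subset_iff)
    next
      case (Basis s)
      then consider "s = cjslat_hom L two" | l where "l \<in> carrier L" "s = d_basic L l" by auto
      then show ?case
      proof cases
        case 1
        then show ?thesis
          using top' gtop by (metis opens_frame_top openin_topspace topspace_d_space)
      next
        case 2
        have "compose (carrier L) g' (d_unit L) l = compose (carrier L) g (d_unit L) l"
          using g' g_f by simp
        then show ?thesis
          using 2 openin_d_basic by (simp add: compose_eq d_unit_def)
      qed
    qed
    show "g' = g"
    proof (rule extensionalityI)
      show "g' \<in> extensional (carrier ?D)"
        using g' by (auto simp: frame_hom_def d_frame_def PiE_def)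
      show "g \<in> extensional (carrier ?D)"
        by (simp add: g_def)
      show "g' U = g U" if "U \<in> carrier ?D" for U
        using that eq by (simp add: d_space_def openin_topology_generated_by_iff)
    qed
  qed
qed

end

theory Submission
  imports Defs
begin

text \<open>Join-preserving maps from a complete lattice \<open>L\<close> to \<open>two\<close> are the points of \<open>d_space L\<close>, and each is
  of the form \<open>l \<mapsto> \<not> l \<le> n\<close> for a unique \<open>n\<close>. For \<open>L = Thick K\<close> these points are the thick
  subcategories \<open>N\<close> of \<open>K\<close>, and \<open>N\<close> lies in the basic open set of \<open>thick K {x}\<close> iff
  \<open>x \<notin> N\<close>. The space \<open>fSpcnt K\<close> is the soberification of this space.

  A support datum \<open>\<sigma>\<close> on a space \<open>X\<close> amounts to a continuous map from \<open>X\<close> to that space of thick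
  subcategories. The axioms say that for every \<open>t\<close> the objects \<open>x\<close> with \<open>t \<notin> \<sigma> x\<close> form a thick
  subcategory (\<open>thick_subcategory_not_supported\<close>). Sending \<open>t\<close> to it is continuous because the
  \<open>\<sigma> x\<close> are open, and composing with the map to the soberification gives the classifying map. It is
  unique because frame maps out of \<open>d_frame L\<close> are determined on the image of \<open>L\<close>
  (\<open>frame_hom_d_frame_eqI\<close>) and every thick subcategory is a join of singly generated ones
  (\<open>frame_hom_d_unit_thick\<close>); together these form \<open>supp_universal\<close>.

  That \<open>supp\<close> is itself a support datum reduces to equalities between generated thick subcategories.
  The one with content is that \<open>x \<oplus> y\<close> lies in every thick subcategory containing \<open>x\<close> and
  \<open>y\<close>; it needs the split triangle \<open>x \<rightarrow> x \<oplus> y \<rightarrow> y\<close>, obtained up to isomorphism in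
  \<open>direct_sum_triangle\<close> from the axioms TR1 to TR3.

  Functoriality holds stage by stage. An exact functor pulls thick subcategories back to thick
  subcategories (\<open>thick_subcategory_preimage\<close>), so \<open>Thick_map\<close> has a right adjoint and preserves
  joins; \<open>d_map\<close> is a functor by uniqueness in its universal property; \<open>pt_map\<close> is precomposition.
  Soberness holds for the points of any frame (\<open>sober_space_pt\<close>).\<close>

section \<open>Join-preserving maps and frame maps\<close>

lemma cjslat_hom_closed: "\<lbrakk>f \<in> cjslat_hom L M; x \<in> carrier L\<rbrakk> \<Longrightarrow> f x \<in> carrier M"
  by (auto simp: cjslat_hom_def)

lemma frame_hom_closed: "\<lbrakk>g \<in> frame_hom F G; x \<in> carrier F\<rbrakk> \<Longrightarrow> g x \<in> carrier G"
  by (auto simp: frame_hom_def)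

lemma sup_pres_compose:
  assumes "sup_pres L M f" "sup_pres M N g" "f \<in> carrier L \<rightarrow> carrier M"
  shows "sup_pres L N (compose (carrier L) g f)"
proof -
  interpret L: complete_lattice L using assms(1) by (simp add: sup_pres_def)
  have "compose (carrier L) g f (\<Squnion>\<^bsub>L\<^esub> A) = \<Squnion>\<^bsub>N\<^esub> (compose (carrier L) g f ` A)"
    if A: "A \<subseteq> carrier L" for A
  proof -
    have "f ` A \<subseteq> carrier M"
      using A assms(3) by auto
    then have "compose (carrier L) g f (\<Squnion>\<^bsub>L\<^esub> A) = \<Squnion>\<^bsub>N\<^esub> (g ` f ` A)"
      using assms A by (simp add: compose_eq sup_pres_def)
    also have "g ` f ` A = compose (carrier L) g f ` A"
      unfolding image_image using A by (intro image_cong) (auto simp: compose_eq)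
    finally show ?thesis .
  qed
  then show ?thesis
    using assms by (simp add: sup_pres_def)
qed

lemma cjslat_hom_compose:
  assumes f: "f \<in> cjslat_hom L M" and g: "g \<in> cjslat_hom M N"
  shows "compose (carrier L) g f \<in> cjslat_hom L N"
proof -
  have "f \<in> carrier L \<rightarrow> carrier M" "g \<in> carrier M \<rightarrow> carrier N"
    using f g by (auto simp: cjslat_hom_def)
  moreover from this have "compose (carrier L) g f \<in> carrier L \<rightarrow>\<^sub>E carrier N"
    by (auto simp: compose_def)
  moreover have "isotone L N (compose (carrier L) g f)"
    using f g unfolding cjslat_hom_def isotone_def by (auto simp: compose_eq PiE_iff)
  ultimately show ?thesis
    using f g sup_pres_compose[of L M f N g]
    by (simp add: cjslat_hom_def)
qed

lemma frame_hom_compose: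
  assumes f: "f \<in> frame_hom F G" and g: "g \<in> frame_hom G H"
  shows "compose (carrier F) g f \<in> frame_hom F H"
proof -
  interpret F: complete_lattice F using f by (simp add: frame_hom_def sup_pres_def)
  have fc: "f \<in> carrier F \<rightarrow> carrier G" and gc: "g \<in> carrier G \<rightarrow> carrier H"
    using f g by (auto simp: frame_hom_def)
  have "meet_pres F H (compose (carrier F) g f)"
    using f g fc unfolding frame_hom_def meet_pres_def by (auto simp: compose_eq Pi_iff)
  moreover have "compose (carrier F) g f \<in> carrier F \<rightarrow>\<^sub>E carrier H"
    using fc gc by (auto simp: compose_def)
  moreover have "compose (carrier F) g f \<top>\<^bsub>F\<^esub> = \<top>\<^bsub>H\<^esub>"
    using f g by (simp add: frame_hom_def compose_eq)
  ultimately show ?thesis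
    using f g fc gc sup_pres_compose[of F G f H g] by (simp add: frame_hom_def)
qed

lemma frame_hom_id:
  assumes "complete_lattice F"
  shows "(\<lambda>x \<in> carrier F. x) \<in> frame_hom F F"
proof -
  interpret complete_lattice F by fact
  have "(\<lambda>x \<in> carrier F. x) ` A = A" if "A \<subseteq> carrier F" for A
    using that by force
  then show ?thesis
    using assms lattice_axioms by (simp add: frame_hom_def sup_pres_def meet_pres_def)
qed

lemma frame_hom_imp_cjslat_hom:
  assumes "g \<in> frame_hom F G"
  shows "g \<in> cjslat_hom F G"
  using assms meet_pres_isotone[of g F G] by (auto simp: frame_hom_def cjslat_hom_def)

lemma spatial_frame_two: "spatial_frame two"
proof -
  have "is_frame two"
    by (auto simp: is_frame_def complete_lattice_two two_meet two_sup image_iff)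
  moreover have "(\<lambda>x \<in> carrier two. x) \<in> frame_hom two two"
    by (rule frame_hom_id[OF complete_lattice_two])
  ultimately show ?thesis
    unfolding spatial_frame_def by (intro conjI ballI impI bexI) simp_all
qed


section \<open>The left adjoint is determined by its unit\<close>

text \<open>This is the uniqueness half of the universal property of \<open>d_frame L\<close>. It proves functoriality of
  \<open>d_map\<close> and, for \<open>F = two\<close>, says that a point of \<open>pt (d_frame L)\<close> is known from its values at
  elements of \<open>L\<close>.\<close>

lemma frame_hom_d_frame_eqI:
  assumes L: "complete_lattice L" and F: "spatial_frame F"
    and g: "g \<in> frame_hom (d_frame L) F" and h: "h \<in> frame_hom (d_frame L) F"
    and eq: "\<And>l. l \<in> carrier L \<Longrightarrow> g (d_unit L l) = h (d_unit L l)"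
  shows "g = h"
proof -
  have "compose (carrier L) g (d_unit L) \<in> cjslat_hom L F"
    using cjslat_hom_compose[OF d_unit_in_hom[OF L] frame_hom_imp_cjslat_hom[OF g]] .
  moreover have "compose (carrier L) h (d_unit L) = compose (carrier L) g (d_unit L)"
    using eq by (auto simp: compose_def)
  ultimately show ?thesis
    using d_universal[OF L F] g h by blast
qed

lemma d_map:
  assumes L: "complete_lattice L" and M: "complete_lattice M" and f: "f \<in> cjslat_hom L M"
  shows d_map_in_hom: "d_map L M f \<in> frame_hom (d_frame L) (d_frame M)"
    and d_map_unit: "l \<in> carrier L \<Longrightarrow> d_map L M f (d_unit L l) = d_unit M (f l)"
proof -
  have "compose (carrier L) (d_unit M) f \<in> cjslat_hom L (d_frame M)"
    using cjslat_hom_compose[OF f d_unit_in_hom[OF M]] .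
  then have *: "d_map L M f \<in> frame_hom (d_frame L) (d_frame M) \<and>
      compose (carrier L) (d_map L M f) (d_unit L) = compose (carrier L) (d_unit M) f"
    unfolding d_map_def d_transpose_def
    by (rule theI'[OF d_universal[OF L spatial_frame_d_frame]])
  then show "d_map L M f \<in> frame_hom (d_frame L) (d_frame M)"
    by blast
  assume l: "l \<in> carrier L"
  have "compose (carrier L) (d_map L M f) (d_unit L) l = compose (carrier L) (d_unit M) f l"
    using * by simp
  then show "d_map L M f (d_unit L l) = d_unit M (f l)"
    using l by (simp add: compose_eq)
qed

lemma complete_lattice_d_frame: "complete_lattice (d_frame L)"
  by (simp add: d_frame_def complete_lattice_opens_frame)

lemma is_frame_d_frame: "is_frame (d_frame L)"
  by (simp add: d_frame_def is_frame_opens_frame)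

lemma d_unit_closed: "l \<in> carrier L \<Longrightarrow> d_unit L l \<in> carrier (d_frame L)"
  by (simp add: d_unit_def d_frame_def openin_d_basic)

lemma cjslat_hom_id:
  assumes "complete_lattice L"
  shows "(\<lambda>x \<in> carrier L. x) \<in> cjslat_hom L L"
  using frame_hom_id[OF assms] by (rule frame_hom_imp_cjslat_hom)

lemma d_map_id:
  assumes L: "complete_lattice L"
  shows "d_map L L (\<lambda>x \<in> carrier L. x) = (\<lambda>U \<in> carrier (d_frame L). U)"
  by (rule frame_hom_d_frame_eqI[OF L spatial_frame_d_frame[of L]])
    (simp_all add: d_map_in_hom d_map_unit L cjslat_hom_id frame_hom_id complete_lattice_d_frame
      d_unit_closed)

lemma d_map_compose:
  assumes L: "complete_lattice L" and M: "complete_lattice M" and N: "complete_lattice N"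
    and f: "f \<in> cjslat_hom L M" and g: "g \<in> cjslat_hom M N"
  shows "d_map L N (compose (carrier L) g f) = compose (carrier (d_frame L)) (d_map M N g) (d_map L M f)"
  by (rule frame_hom_d_frame_eqI[OF L spatial_frame_d_frame[of N]])
    (simp_all add: assms d_map_in_hom d_map_unit cjslat_hom_compose[OF f g] frame_hom_compose[of _ _ "d_frame M"]
      d_unit_closed compose_eq cjslat_hom_closed[OF f])


section \<open>The space of points of a frame\<close>

text \<open>The generic point of an irreducible closed set \<open>C\<close> sends \<open>l\<close> to \<open>True\<close> iff \<open>C\<close> meets
  \<open>pt_open F l\<close>. Irreducibility of \<open>C\<close> says exactly that this map preserves binary meets. Since
  \<open>q\<close> lies in the closure of \<open>p\<close> iff \<open>q \<le> p\<close> pointwise, a point is determined by its closure.\<close>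

lemma sober_space_pt:
  assumes F: "is_frame F"
  shows "sober_space (pt F)"
proof -
  interpret complete_lattice F using F by (simp add: is_frame_def)
  note top = topspace_pt[OF F] and op = openin_pt_iff[OF F]
  have in_cl: "(q \<in> pt F closure_of {p}) \<longleftrightarrow> q \<in> frame_hom F two \<and> (\<forall>l \<in> carrier F. q l \<longrightarrow> p l)"
    if "p \<in> frame_hom F two" for p q
  proof -
    have "(q \<in> pt F closure_of {p}) \<longleftrightarrow>
        q \<in> frame_hom F two \<and> (\<forall>l \<in> carrier F. q \<in> pt_open F l \<longrightarrow> p \<in> pt_open F l)"
      unfolding in_closure_of top op by blast
    then show ?thesis
      using that by (auto simp: pt_open_def)
  qed
  show ?thesis
    unfolding sober_space_def
  proof (intro allI impI, elim conjE)
    fix C assume C: "closedin (pt F) C" "C \<noteq> {}"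
      and irr: "\<forall>A B. closedin (pt F) A \<and> closedin (pt F) B \<and> C \<subseteq> A \<union> B \<longrightarrow> C \<subseteq> A \<or> C \<subseteq> B"
    have Csub: "C \<subseteq> frame_hom F two"
      using C(1) closedin_subset top by blast
    define p where "p = (\<lambda>l \<in> carrier F. \<exists>q \<in> C. q l)"
    have p: "p l \<longleftrightarrow> (\<exists>q \<in> C. q l)" if "l \<in> carrier F" for l
      using that by (simp add: p_def)
    have p_meet: "p (a \<sqinter>\<^bsub>F\<^esub> b) \<longleftrightarrow> p a \<and> p b" if ab: "a \<in> carrier F" "b \<in> carrier F" for a b
    proof -
      have "p (a \<sqinter>\<^bsub>F\<^esub> b) \<longleftrightarrow> (\<exists>q \<in> C. q a \<and> q b)"
        unfolding p[OF meet_closed[OF ab]]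
        using frame_hom_two_meet[OF subsetD[OF Csub] ab] by (intro bex_cong) simp_all
      moreover have "\<exists>q \<in> C. q a \<and> q b" if "p a" "p b"
      proof (rule ccontr)
        assume none: "\<not> (\<exists>q \<in> C. q a \<and> q b)"
        define cl where "cl l = frame_hom F two - pt_open F l" for l
        have "closedin (pt F) (cl a)" "closedin (pt F) (cl b)"
          unfolding cl_def top[symmetric] using ab op by blast+
        moreover have "C \<subseteq> cl a \<union> cl b"
          using none Csub by (auto simp: cl_def pt_open_def)
        ultimately have "C \<subseteq> cl a \<or> C \<subseteq> cl b"
          using irr by blast
        then show False
          using that p[OF ab(1)] p[OF ab(2)] Csub by (auto simp: cl_def pt_open_def)
      qed
      ultimately show ?thesis
        using p[OF ab(1)] p[OF ab(2)] by blast
    qed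
    have p_sup: "p (\<Squnion>\<^bsub>F\<^esub> A) \<longleftrightarrow> (\<exists>a \<in> A. p a)" if A: "A \<subseteq> carrier F" for A
    proof -
      have "p (\<Squnion>\<^bsub>F\<^esub> A) \<longleftrightarrow> (\<exists>q \<in> C. \<exists>a \<in> A. q a)"
        unfolding p[OF sup_closed[OF A]]
        using frame_hom_two_sup[OF subsetD[OF Csub] A] by (intro bex_cong) simp_all
      also have "\<dots> \<longleftrightarrow> (\<exists>a \<in> A. p a)"
        using A p by blast
      finally show ?thesis .
    qed
    have "p \<top>\<^bsub>F\<^esub>"
      unfolding p[OF top_closed] using C(2) frame_hom_two_top[OF subsetD[OF Csub]] by blast
    then have p_pt: "p \<in> frame_hom F two"
      using p_meet p_sup by (simp add: frame_hom_two_iff complete_lattice_axioms p_def)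
    obtain c where c: "c \<in> carrier F" "frame_hom F two - C = pt_open F c"
      using C(1) op top unfolding closedin_def by auto
    have cl_p: "pt F closure_of {p} = C"
    proof (intro subset_antisym subsetI)
      fix q assume q: "q \<in> pt F closure_of {p}"
      have "\<not> p c"
        using c p[OF c(1)] Csub by (auto simp: pt_open_def)
      then have "q \<in> frame_hom F two" "\<not> q c"
        using q c(1) by (auto simp: in_cl[OF p_pt])
      then show "q \<in> C"
        using c(2) by (auto simp: pt_open_def)
    next
      fix q assume "q \<in> C"
      then show "q \<in> pt F closure_of {p}"
        unfolding in_cl[OF p_pt] using Csub p by blast
    qed
    have "q = p" if q: "q \<in> frame_hom F two" "pt F closure_of {q} = C" for q
    proof (rule extensionalityI)
      show "q \<in> extensional (carrier F)" "p \<in> extensional (carrier F)"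
        using q(1) p_pt by (auto simp: frame_hom_two_iff)
      fix l assume l: "l \<in> carrier F"
      have "p \<in> C" "q \<in> C"
        using in_cl[OF p_pt, of p] in_cl[OF q(1), of q] p_pt q cl_p by simp_all
      then have "p l \<longrightarrow> q l" "q l \<longrightarrow> p l"
        using in_cl[OF p_pt, of q] in_cl[OF q(1), of p] q(2) cl_p l by simp_all
      then show "q l = p l"
        by blast
    qed
    then show "\<exists>!x. x \<in> topspace (pt F) \<and> pt F closure_of {x} = C"
      unfolding top using p_pt cl_p by blast
  qed
qed

lemma pt_map_in_sob_hom:
  assumes F: "is_frame F" and G: "is_frame G" and g: "g \<in> frame_hom F G"
  shows "pt_map F G g \<in> sob_hom (pt G) (pt F)"
proof -
  have closed: "pt_map F G g p \<in> frame_hom F two" if "p \<in> frame_hom G two" for p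
    using that frame_hom_compose[OF g that] by (simp add: pt_map_def)
  have "{p \<in> frame_hom G two. pt_map F G g p \<in> pt_open F l} = pt_open G (g l)"
    if "l \<in> carrier F" for l
    using that closed by (auto simp: pt_open_def pt_map_def compose_eq)
  then have "openin (pt G) {p \<in> frame_hom G two. pt_map F G g p \<in> pt_open F l}"
    if "l \<in> carrier F" for l
    using that frame_hom_closed[OF g] openin_pt_iff[OF G] by auto
  then have "continuous_map (pt G) (pt F) (pt_map F G g)"
    using closed by (auto simp: continuous_map_def topspace_pt F G openin_pt_iff[OF F])
  then show ?thesis
    using closed by (auto simp: sob_hom_def topspace_pt F G pt_map_def)
qed

lemma pt_map_id: "pt_map F F (\<lambda>x \<in> carrier F. x) = (\<lambda>p \<in> frame_hom F two. p)"
proof (rule ext)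
  fix p
  have "compose (carrier F) p (\<lambda>x \<in> carrier F. x) = p" if "p \<in> frame_hom F two"
    using that by (intro extensionalityI[of _ "carrier F"]) (auto simp: frame_hom_two_iff compose_def)
  then show "pt_map F F (\<lambda>x \<in> carrier F. x) p = (\<lambda>p \<in> frame_hom F two. p) p"
    by (simp add: pt_map_def)
qed

lemma pt_map_compose:
  assumes g: "g \<in> frame_hom F G" and h: "h \<in> frame_hom G H"
  shows "pt_map F H (compose (carrier F) h g) =
    compose (frame_hom H two) (pt_map F G g) (pt_map G H h)"
proof (rule ext)
  fix p
  show "pt_map F H (compose (carrier F) h g) p =
    compose (frame_hom H two) (pt_map F G g) (pt_map G H h) p"
    using frame_hom_compose[OF h, of p two] frame_hom_closed[OF g]
    by (auto simp: pt_map_def compose_def)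
qed

section \<open>Points given by elements of a lattice\<close>

lemma frame_hom_opens_frame_point:
  assumes "t \<in> topspace X"
  shows "(\<lambda>U \<in> carrier (opens_frame X). t \<in> U) \<in> frame_hom (opens_frame X) two"
proof -
  have "(\<lambda>U \<in> carrier (opens_frame X). t \<in> U) (\<Squnion>\<^bsub>opens_frame X\<^esub> A) \<longleftrightarrow>
      (\<exists>U \<in> A. (\<lambda>U \<in> carrier (opens_frame X). t \<in> U) U)"
    if A: "A \<subseteq> {U. openin X U}" for A
    using A openin_Union[of A X] by (auto simp: opens_frame_sup subset_iff)
  then show ?thesis
    using assms by (auto simp: frame_hom_two_iff complete_lattice_opens_frame opens_frame_meet
      opens_frame_top openin_Int)
qed

text \<open>Every join-preserving map to \<open>two\<close> has this form, with \<open>n\<close> the join of all elements sent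
  to \<open>False\<close>. So the points of \<open>d_space (Thick K)\<close> are given by thick subcategories.\<close>

definition not_below :: "'a gorder \<Rightarrow> 'a \<Rightarrow> 'a \<Rightarrow> bool" where
  "not_below L n = (\<lambda>l \<in> carrier L. \<not> l \<sqsubseteq>\<^bsub>L\<^esub> n)"

lemma not_below_in_hom:
  assumes "complete_lattice L" "n \<in> carrier L"
  shows "not_below L n \<in> cjslat_hom L two"
proof -
  interpret complete_lattice L by fact
  have "\<Squnion>\<^bsub>L\<^esub> A \<sqsubseteq>\<^bsub>L\<^esub> n \<longleftrightarrow> (\<forall>a \<in> A. a \<sqsubseteq>\<^bsub>L\<^esub> n)" if A: "A \<subseteq> carrier L" for A
    using A assms(2) sup_least sup_upper by (meson le_trans subset_iff sup_closed)
  then show ?thesis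
    using assms by (auto simp: cjslat_hom_two_iff not_below_def subset_iff)
qed


section \<open>Additive categories and additive functors\<close>

context category
begin

lemma Hom_objects: "f \<in> Hom C a b \<Longrightarrow> a \<in> Obj C \<and> b \<in> Obj C"
  using Dom_in_Obj Cod_in_Obj by (auto simp: Hom_def)

lemma isomorphicI:
  assumes "f \<in> Hom C a b" "g \<in> Hom C b a" "g \<cdot> f = Id C a" "f \<cdot> g = Id C b"
  shows "isomorphic C a b"
  using assms unfolding isomorphic_def is_iso_def by (auto simp: Hom_def)

lemma isomorphicE:
  assumes "isomorphic C a b"
  obtains f g where "f \<in> Hom C a b" "g \<in> Hom C b a" "g \<cdot> f = Id C a" "f \<cdot> g = Id C b"
  using assms unfolding isomorphic_def is_iso_def by (auto simp: Hom_def)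

lemma isomorphic_sym: "isomorphic C a b \<Longrightarrow> isomorphic C b a"
  by (metis isomorphicE isomorphicI)

lemma is_iso_imp_isomorphic: "\<lbrakk>f \<in> Hom C a b; is_iso C f\<rbrakk> \<Longrightarrow> isomorphic C a b"
  unfolding isomorphic_def by blast

end

context additive_category
begin

lemma Hom_group_simps [simp]:
  "carrier (Hom_group C a b) = Hom C a b"
  "f \<otimes>\<^bsub>Hom_group C a b\<^esub> g = f \<boxplus> g"
  "\<one>\<^bsub>Hom_group C a b\<^esub> = Zero C a b"
  by (simp_all add: Hom_group_def)

lemma Zero_in_Hom: "\<lbrakk>a \<in> Obj C; b \<in> Obj C\<rbrakk> \<Longrightarrow> Zero C a b \<in> Hom C a b"
  using comm_group.axioms(1)[OF Hom_comm_group] monoid.one_closed comm_monoid.axioms(1)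
    Hom_group_simps by metis

lemma group_Hom:
  assumes "f \<in> Hom C a b"
  shows "group (Hom_group C a b)"
  using comm_group.axioms(2)[OF Hom_comm_group] Hom_objects[OF assms] by blast

lemma Add_in_Hom:
  assumes "f \<in> Hom C a b" "g \<in> Hom C a b"
  shows "f \<boxplus> g \<in> Hom C a b"
  using monoid.m_closed[OF group.is_monoid[OF group_Hom[OF assms(1)]], of f g] assms by simp

lemma Add_Zero:
  assumes "f \<in> Hom C a b"
  shows "f \<boxplus> Zero C a b = f" "Zero C a b \<boxplus> f = f"
  using monoid.r_one[OF group.is_monoid[OF group_Hom[OF assms]], of f]
    monoid.l_one[OF group.is_monoid[OF group_Hom[OF assms]], of f] assms by simp_all

lemma Add_cancel_right:
  assumes "f \<in> Hom C a b" "g \<in> Hom C a b" "h \<in> Hom C a b" "f \<boxplus> h = g \<boxplus> h"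
  shows "f = g"
  using group.right_cancel[OF group_Hom[OF assms(1)], of h f g] assms by simp

lemma Add_idem_imp_Zero:
  assumes "f \<in> Hom C a b" "f \<boxplus> f = f"
  shows "f = Zero C a b"
  using Add_cancel_right[OF assms(1) _ assms(1)] Add_Zero[OF assms(1)] assms
    Zero_in_Hom Hom_objects[OF assms(1)] by metis

lemma Neg_in_Hom:
  assumes "f \<in> Hom C a b"
  shows "Neg C f \<in> Hom C a b" "f \<boxplus> Neg C f = Zero C a b" "Neg C f \<boxplus> f = Zero C a b"
proof -
  have "Neg C f = inv\<^bsub>Hom_group C a b\<^esub> f"
    using assms by (simp add: Neg_def Hom_def)
  then show "Neg C f \<in> Hom C a b" "f \<boxplus> Neg C f = Zero C a b" "Neg C f \<boxplus> f = Zero C a b"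
    using group.inv_closed[OF group_Hom[OF assms]] group.r_inv[OF group_Hom[OF assms]]
      group.l_inv[OF group_Hom[OF assms]] assms by simp_all
qed

lemma Neg_Zero: "\<lbrakk>a \<in> Obj C; b \<in> Obj C\<rbrakk> \<Longrightarrow> Neg C (Zero C a b) = Zero C a b"
  using Neg_in_Hom[OF Zero_in_Hom] Add_Zero(2) by metis

lemma ex_difference:
  assumes f: "f \<in> Hom C a b" and g: "g \<in> Hom C a b"
  obtains d where "d \<in> Hom C a b" "d \<boxplus> g = f"
proof
  show "f \<boxplus> Neg C g \<in> Hom C a b"
    by (rule Add_in_Hom[OF f Neg_in_Hom(1)[OF g]])
  have "(f \<boxplus> Neg C g) \<boxplus> g = f \<boxplus> (Neg C g \<boxplus> g)"
    using monoid.m_assoc[OF group.is_monoid[OF group_Hom[OF f]], of f "Neg C g" g]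
      f g Neg_in_Hom(1)[OF g] by simp
  then show "(f \<boxplus> Neg C g) \<boxplus> g = f"
    using Neg_in_Hom(3)[OF g] Add_Zero(1)[OF f] by simp
qed

lemma Comp_Zero_left:
  assumes "f \<in> Hom C a b" "c \<in> Obj C"
  shows "Zero C b c \<cdot> f = Zero C a c"
proof (rule Add_idem_imp_Zero)
  have Z: "Zero C b c \<in> Hom C b c"
    using assms Hom_objects Zero_in_Hom by blast
  then show "Zero C b c \<cdot> f \<in> Hom C a c"
    using assms Comp_in_Hom by blast
  show "Zero C b c \<cdot> f \<boxplus> Zero C b c \<cdot> f = Zero C b c \<cdot> f"
    using Comp_Add_left[OF assms(1) Z Z] Add_Zero[OF Z] by simp
qed

lemma Comp_Zero_right:
  assumes "f \<in> Hom C b c" "a \<in> Obj C"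
  shows "f \<cdot> Zero C a b = Zero C a c"
proof (rule Add_idem_imp_Zero)
  have Z: "Zero C a b \<in> Hom C a b"
    using assms Hom_objects Zero_in_Hom by blast
  then show "f \<cdot> Zero C a b \<in> Hom C a c"
    using assms Comp_in_Hom by blast
  show "f \<cdot> Zero C a b \<boxplus> f \<cdot> Zero C a b = f \<cdot> Zero C a b"
    using Comp_Add_right[OF Z Z assms(1)] Add_Zero[OF Z] by simp
qed

lemma zero_object_iff: "zero_object C z \<longleftrightarrow> z \<in> Obj C \<and> Id C z = Zero C z z"
proof
  assume "zero_object C z"
  then show "z \<in> Obj C \<and> Id C z = Zero C z z"
    using Id_in_Hom Zero_in_Hom unfolding zero_object_def by blast
next
  assume z: "z \<in> Obj C \<and> Id C z = Zero C z z"
  have "\<exists>!f. f \<in> Hom C z a" if a: "a \<in> Obj C" for a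
  proof (rule ex1I)
    show "Zero C z a \<in> Hom C z a"
      using z a Zero_in_Hom by blast
    show "f = Zero C z a" if "f \<in> Hom C z a" for f
      using Comp_Id_right[OF that] Comp_Zero_right[OF that] z by simp
  qed
  moreover have "\<exists>!f. f \<in> Hom C a z" if a: "a \<in> Obj C" for a
  proof (rule ex1I)
    show "Zero C a z \<in> Hom C a z"
      using z a Zero_in_Hom by blast
    show "f = Zero C a z" if "f \<in> Hom C a z" for f
      using Comp_Id_left[OF that] Comp_Zero_left[OF that] z by simp
  qed
  ultimately show "zero_object C z"
    using z by (simp add: zero_object_def)
qed

lemma direct_sum_objects:
  "direct_sum C x y s \<Longrightarrow> x \<in> Obj C \<and> y \<in> Obj C \<and> s \<in> Obj C"
  unfolding direct_sum_def using Hom_objects by blast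

text \<open>The axioms of a support datum do not mention isomorphisms; invariance under isomorphism comes from
  additivity on direct sums with a zero object.\<close>

lemma direct_sum_zero_object:
  assumes xy: "isomorphic C x y" and z: "zero_object C z"
  shows "direct_sum C x z y"
proof -
  obtain f g where fg: "f \<in> Hom C x y" "g \<in> Hom C y x" "g \<cdot> f = Id C x" "f \<cdot> g = Id C y"
    using isomorphicE[OF xy] by blast
  have obj: "x \<in> Obj C" "y \<in> Obj C" "z \<in> Obj C" and zz: "Id C z = Zero C z z"
    using z fg Hom_objects by (auto simp: zero_object_iff)
  note Z = Zero_in_Hom[OF obj(3) obj(2)] Zero_in_Hom[OF obj(2) obj(3)]
  have "f \<cdot> g \<boxplus> Zero C z y \<cdot> Zero C y z = Id C y"
    using fg(4) Comp_Zero_right[OF Z(1) obj(2)] Add_Zero(1)[OF Id_in_Hom[OF obj(2)]] by simp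
  then show ?thesis
    unfolding direct_sum_def
    using fg Z zz Comp_Zero_left[OF fg(1) obj(3)] Comp_Zero_right[OF fg(2) obj(3)]
      Comp_Zero_left[OF Z(1) obj(3)] by metis
qed

end

lemma is_functorD:
  assumes "is_functor C D F"
  shows "x \<in> Obj C \<Longrightarrow> omap F x \<in> Obj D"
    and "f \<in> Hom C a b \<Longrightarrow> amap F f \<in> Hom D (omap F a) (omap F b)"
    and "a \<in> Obj C \<Longrightarrow> amap F (Id C a) = Id D (omap F a)"
    and "\<lbrakk>f \<in> Hom C a b; g \<in> Hom C b c\<rbrakk> \<Longrightarrow> amap F (g \<cdot>\<^bsub>C\<^esub> f) = amap F g \<cdot>\<^bsub>D\<^esub> amap F f"
  using assms unfolding is_functor_def by (auto simp: PiE_iff)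

lemma functor_isomorphic:
  assumes C: "category C" and D: "category D" and F: "is_functor C D F" and xy: "isomorphic C x y"
  shows "isomorphic D (omap F x) (omap F y)"
proof -
  obtain f g where fg: "f \<in> Hom C x y" "g \<in> Hom C y x" "g \<cdot>\<^bsub>C\<^esub> f = Id C x" "f \<cdot>\<^bsub>C\<^esub> g = Id C y"
    using category.isomorphicE[OF C xy] by blast
  have "x \<in> Obj C" "y \<in> Obj C"
    using category.Hom_objects[OF C fg(1)] by auto
  then show ?thesis
    using is_functorD(2,3)[OF F] is_functorD(4)[OF F fg(1,2)] is_functorD(4)[OF F fg(2,1)] fg
    by (intro category.isomorphicI[OF D, of "amap F f" _ _ "amap F g"]) auto
qed

lemma additive_functorD:
  assumes "additive_functor C D F"
  shows "is_functor C D F"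
    and "\<lbrakk>f \<in> Hom C a b; g \<in> Hom C a b\<rbrakk> \<Longrightarrow> amap F (f \<boxplus>\<^bsub>C\<^esub> g) = amap F f \<boxplus>\<^bsub>D\<^esub> amap F g"
  using assms unfolding additive_functor_def by blast+

lemma additive_functor_Zero:
  assumes C: "additive_category C" and D: "additive_category D" and F: "additive_functor C D F"
    and ab: "a \<in> Obj C" "b \<in> Obj C"
  shows "amap F (Zero C a b) = Zero D (omap F a) (omap F b)"
proof (rule additive_category.Add_idem_imp_Zero[OF D])
  have Z: "Zero C a b \<in> Hom C a b"
    by (rule additive_category.Zero_in_Hom[OF C ab])
  then show "amap F (Zero C a b) \<in> Hom D (omap F a) (omap F b)"
    using is_functorD(2)[OF additive_functorD(1)[OF F]] by blast
  show "amap F (Zero C a b) \<boxplus>\<^bsub>D\<^esub> amap F (Zero C a b) = amap F (Zero C a b)"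
    using additive_functorD(2)[OF F Z Z] additive_category.Add_Zero(1)[OF C Z] by simp
qed

lemma additive_functor_zero_object:
  assumes C: "additive_category C" and D: "additive_category D" and F: "additive_functor C D F"
    and z: "zero_object C z"
  shows "zero_object D (omap F z)"
proof -
  have z': "z \<in> Obj C" "Id C z = Zero C z z"
    using z additive_category.zero_object_iff[OF C] by auto
  then show ?thesis
    using is_functorD(1,3)[OF additive_functorD(1)[OF F] z'(1)] additive_functor_Zero[OF C D F z'(1) z'(1)]
      additive_category.zero_object_iff[OF D] by simp
qed

lemma additive_functor_direct_sum:
  assumes C: "additive_category C" and D: "additive_category D" and F: "additive_functor C D F"
    and s: "direct_sum C x y s"
  shows "direct_sum D (omap F x) (omap F y) (omap F s)"
proof -
  interpret C: additive_category C by fact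
  note fu = is_functorD[OF additive_functorD(1)[OF F]]
  obtain i j p q where h: "i \<in> Hom C x s" "j \<in> Hom C y s" "p \<in> Hom C s x" "q \<in> Hom C s y"
    and e: "p \<cdot>\<^bsub>C\<^esub> i = Id C x" "q \<cdot>\<^bsub>C\<^esub> j = Id C y" "q \<cdot>\<^bsub>C\<^esub> i = Zero C x y" "p \<cdot>\<^bsub>C\<^esub> j = Zero C y x"
      "(i \<cdot>\<^bsub>C\<^esub> p) \<boxplus>\<^bsub>C\<^esub> (j \<cdot>\<^bsub>C\<^esub> q) = Id C s"
    using s unfolding direct_sum_def by blast
  have obj: "x \<in> Obj C" "y \<in> Obj C" "s \<in> Obj C"
    using h C.Hom_objects by blast+
  have "(amap F i \<cdot>\<^bsub>D\<^esub> amap F p) \<boxplus>\<^bsub>D\<^esub> (amap F j \<cdot>\<^bsub>D\<^esub> amap F q) = Id D (omap F s)"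
    using additive_functorD(2)[OF F C.Comp_in_Hom[OF h(3,1)] C.Comp_in_Hom[OF h(4,2)]]
      fu(4)[OF h(3,1)] fu(4)[OF h(4,2)] fu(3)[OF obj(3)] e(5) by simp
  moreover have "amap F p \<cdot>\<^bsub>D\<^esub> amap F i = Id D (omap F x)" "amap F q \<cdot>\<^bsub>D\<^esub> amap F j = Id D (omap F y)"
    "amap F q \<cdot>\<^bsub>D\<^esub> amap F i = Zero D (omap F x) (omap F y)"
    "amap F p \<cdot>\<^bsub>D\<^esub> amap F j = Zero D (omap F y) (omap F x)"
    using fu(4)[OF h(1,3)] fu(4)[OF h(2,4)] fu(4)[OF h(1,4)] fu(4)[OF h(2,3)] e
      fu(3)[OF obj(1)] fu(3)[OF obj(2)] additive_functor_Zero[OF C D F] obj by simp_all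
  ultimately show ?thesis
    unfolding direct_sum_def using h[THEN fu(2)] by blast
qed

section \<open>Split triangles\<close>

context triangulated_category
begin

lemmas Shift_functor = additive_functorD(1)[OF Shift_additive]

lemma triangle_Hom:
  assumes "triangle K x y z f g h"
  shows "f \<in> Hom K x y" "g \<in> Hom K y z" "h \<in> Hom K z (omap (Shift K) x)"
  using assms by (simp_all add: triangle_def candidate_triangle_def)

lemma triangle_objects:
  "triangle K x y z f g h \<Longrightarrow> x \<in> Obj K \<and> y \<in> Obj K \<and> z \<in> Obj K"
  by (meson triangle_Hom(1,2) Hom_objects)

lemma triangle_rotate:
  assumes "triangle K x y z f g h"
  shows "triangle K y z (omap (Shift K) x) g h (Neg K (amap (Shift K) f))"
  using assms TR2 unfolding triangle_def by blast

text \<open>The trivial triangle on \<open>x\<close> maps to the given one by TR3, so the composite factors through a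
  zero object.\<close>

lemma triangle_composite_Zero:
  assumes T: "triangle K x y z f g h"
  shows "g \<cdot> f = Zero K x z"
proof -
  note h = triangle_Hom[OF T]
  have x: "x \<in> Obj K" and z: "z \<in> Obj K"
    using triangle_objects[OF T] by auto
  obtain o' where o': "zero_object K o'"
    using ex_zero_object by blast
  then have o'_obj: "o' \<in> Obj K"
    by (simp add: zero_object_iff)
  obtain w where w: "w \<in> Hom K o' z" "w \<cdot> Zero K x o' = g \<cdot> f"
    using TR3[OF TR1_Id[OF x o'] T Id_in_Hom[OF x] h(1) refl] by blast
  then show ?thesis
    using Comp_Zero_right[OF w(1) x] by simp
qed

text \<open>This is the trivial triangle on \<open>t\<close> with the zero object moved to the front: its rotation is
  the triangle of TR1, because the suspension preserves zero objects and zero maps.\<close>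

lemma triangle_zero_Id:
  assumes o': "zero_object K o'" and t: "t \<in> Obj K"
  shows "triangle K o' t t (Zero K o' t) (Id K t) (Zero K t (omap (Shift K) o'))"
proof -
  have obj: "o' \<in> Obj K" "omap (Shift K) o' \<in> Obj K" "omap (Shift K) t \<in> Obj K"
    using o' t is_functorD(1)[OF Shift_functor] by (auto simp: zero_object_iff)
  have z: "zero_object K (omap (Shift K) o')"
    by (rule additive_functor_zero_object[OF additive_category_axioms additive_category_axioms
          Shift_additive o'])
  have "Neg K (amap (Shift K) (Zero K o' t)) = Zero K (omap (Shift K) o') (omap (Shift K) t)"
    using additive_functor_Zero[OF additive_category_axioms additive_category_axioms Shift_additive obj(1) t]
      Neg_Zero[OF obj(2,3)] by simp
  moreover have "candidate_triangle K o' t t (Zero K o' t) (Id K t) (Zero K t (omap (Shift K) o'))"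
    using obj t Zero_in_Hom Id_in_Hom by (simp add: candidate_triangle_def)
  ultimately show ?thesis
    using TR2 TR1_Id[OF t z] by simp
qed

text \<open>The zero map from \<open>x\<close> and \<open>v\<close> form a square to the triangle \<open>0 \<rightarrow> t \<rightarrow> t\<close>, which TR3
  extends.\<close>

lemma triangle_weak_cokernel:
  assumes T: "triangle K x y z f g h" and v: "v \<in> Hom K y t" "v \<cdot> f = Zero K x t"
  obtains w where "w \<in> Hom K z t" "w \<cdot> g = v"
proof -
  have obj: "x \<in> Obj K" "t \<in> Obj K"
    using triangle_objects[OF T] Hom_objects[OF v(1)] by auto
  obtain o' where o': "zero_object K o'"
    using ex_zero_object by blast
  then have o'_obj: "o' \<in> Obj K"
    by (simp add: zero_object_iff)
  have u: "Zero K x o' \<in> Hom K x o'"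
    by (rule Zero_in_Hom[OF obj(1) o'_obj])
  have "v \<cdot> f = Zero K o' t \<cdot> Zero K x o'"
    using Comp_Zero_left[OF u obj(2)] v(2) by simp
  then obtain w where "w \<in> Hom K z t" "w \<cdot> g = Id K t \<cdot> v"
    using TR3[OF T triangle_zero_Id[OF o' obj(2)] u v(1)] by blast
  then show ?thesis
    using that Comp_Id_left[OF v(1)] by simp
qed

text \<open>Rotation makes \<open>\<Sigma>i \<cdot> h\<close> vanish, up to sign, as a composite of consecutive maps of a triangle, and
  \<open>\<Sigma>p\<close> cancels \<open>\<Sigma>i\<close>.\<close>

lemma split_triangle_connecting_Zero:
  assumes T: "triangle K x y z i g h" and p: "p \<in> Hom K y x" "p \<cdot> i = Id K x"
  shows "h = Zero K z (omap (Shift K) x)"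
proof -
  let ?S = "omap (Shift K)" and ?s = "amap (Shift K)"
  note fu = is_functorD[OF Shift_functor]
  note H = triangle_Hom[OF T]
  have obj: "x \<in> Obj K" "y \<in> Obj K" "z \<in> Obj K"
    using triangle_objects[OF T] by auto
  have si: "?s i \<in> Hom K (?S x) (?S y)" and sp: "?s p \<in> Hom K (?S y) (?S x)"
    using fu(2) H(1) p(1) by blast+
  have "Neg K (?s i) \<cdot> h = Zero K z (?S y)"
    using triangle_composite_Zero[OF triangle_rotate[OF triangle_rotate[OF T]]] .
  moreover have "(?s i \<boxplus> Neg K (?s i)) \<cdot> h = Zero K z (?S y)"
    using Neg_in_Hom(2)[OF si] Comp_Zero_left[OF H(3) fu(1)[OF obj(2)]] by simp
  ultimately have "?s i \<cdot> h = Zero K z (?S y)"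
    using Comp_Add_left[OF H(3) si Neg_in_Hom(1)[OF si]] Add_Zero(1)[OF Comp_in_Hom[OF H(3) si]]
    by simp
  then have "(?s p \<cdot> ?s i) \<cdot> h = Zero K z (?S x)"
    using Comp_assoc[OF H(3) si sp] Comp_Zero_right[OF sp obj(3)] by simp
  moreover have "?s p \<cdot> ?s i = Id K (?S x)"
    using fu(4)[OF H(1) p(1)] fu(3)[OF obj(1)] p(2) by simp
  ultimately show ?thesis
    using Comp_Id_left[OF H(3)] by simp
qed

text \<open>Thick subcategories are closed under cones and direct summands; this lemma gives their closure
  under direct sums. For a cone \<open>z\<close> of the inclusion \<open>i\<close> of \<open>x\<close>, the projection of \<open>s\<close> to
  \<open>y\<close> factors as \<open>w \<cdot> g\<close>, and \<open>w\<close> is inverse to \<open>g \<cdot> j\<close>: the difference of \<open>g \<cdot> j \<cdot> w\<close> and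
  the identity of \<open>z\<close> vanishes after composition with \<open>g\<close>, so it factors through \<open>h\<close>, which is
  zero since \<open>i\<close> splits.\<close>

lemma direct_sum_triangle:
  assumes s: "direct_sum K x y s"
  obtains z i g h where "triangle K x s z i g h" "isomorphic K y z"
proof -
  obtain i j p q where H: "i \<in> Hom K x s" "j \<in> Hom K y s" "p \<in> Hom K s x" "q \<in> Hom K s y"
    and e: "p \<cdot> i = Id K x" "q \<cdot> j = Id K y" "q \<cdot> i = Zero K x y"
      "(i \<cdot> p) \<boxplus> (j \<cdot> q) = Id K s"
    using s unfolding direct_sum_def by blast
  obtain z g h where T: "triangle K x s z i g h"
    using TR1_cone[OF H(1)] by blast
  note G = triangle_Hom(2,3)[OF T]
  have obj: "x \<in> Obj K" "s \<in> Obj K" "z \<in> Obj K"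
    using triangle_objects[OF T] by auto
  obtain w where w: "w \<in> Hom K z y" "w \<cdot> g = q"
    using triangle_weak_cokernel[OF T H(4) e(3)] by blast
  have gj: "g \<cdot> j \<in> Hom K y z"
    by (rule Comp_in_Hom[OF H(2) G(1)])
  \<comment> \<open>\<open>i \<cdot> p\<close> is the part of the identity of \<open>s\<close> that \<open>g\<close> annihilates.\<close>
  have "g = g \<cdot> ((i \<cdot> p) \<boxplus> (j \<cdot> q))"
    using Comp_Id_right[OF G(1)] e(4) by simp
  also have "\<dots> = (g \<cdot> i) \<cdot> p \<boxplus> (g \<cdot> j) \<cdot> q"
    using Comp_Add_right[OF Comp_in_Hom[OF H(3,1)] Comp_in_Hom[OF H(4,2)] G(1)]
      Comp_assoc[OF H(3,1) G(1)] Comp_assoc[OF H(4,2) G(1)] by simp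
  also have "\<dots> = (g \<cdot> j) \<cdot> q"
    using triangle_composite_Zero[OF T] Comp_Zero_left[OF H(3) obj(3)]
      Add_Zero(2)[OF Comp_in_Hom[OF H(4) gj]] by simp
  finally have gjq: "(g \<cdot> j) \<cdot> q = g" ..
  have gjw: "(g \<cdot> j) \<cdot> w \<in> Hom K z z"
    by (rule Comp_in_Hom[OF w(1) gj])
  have Iz: "Id K z \<in> Hom K z z"
    by (rule Id_in_Hom[OF obj(3)])
  obtain d where d: "d \<in> Hom K z z" "d \<boxplus> Id K z = (g \<cdot> j) \<cdot> w"
    using ex_difference[OF gjw Iz] by blast
  have "(d \<cdot> g) \<boxplus> g = ((g \<cdot> j) \<cdot> w) \<cdot> g"
    using Comp_Add_left[OF G(1) d(1) Iz] Comp_Id_left[OF G(1)] d(2) by simp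
  also have "\<dots> = Zero K s z \<boxplus> g"
    using Comp_assoc[OF G(1) w(1) gj] w(2) gjq Add_Zero(2)[OF G(1)] by simp
  finally have "d \<cdot> g = Zero K s z"
    using Add_cancel_right[OF Comp_in_Hom[OF G(1) d(1)] Zero_in_Hom[OF obj(2,3)] G(1)] by simp
  then obtain k where k: "k \<in> Hom K (omap (Shift K) x) z" "k \<cdot> h = d"
    using triangle_weak_cokernel[OF triangle_rotate[OF T] d(1)] by blast
  then have "d = Zero K z z"
    using split_triangle_connecting_Zero[OF T H(3) e(1)] Comp_Zero_right[OF k(1) obj(3)] by simp
  then have "(g \<cdot> j) \<cdot> w = Id K z"
    using d(2) Add_Zero(2)[OF Iz] by simp
  moreover have "w \<cdot> (g \<cdot> j) = Id K y"
    using Comp_assoc[OF H(2) G(1) w(1)] w(2) e(2) by simp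
  ultimately have "isomorphic K y z"
    using isomorphicI[OF gj w(1)] by blast
  then show ?thesis
    using that T by blast
qed

lemma natural_iso_isomorphic:
  assumes "natural_iso C K F G \<eta>" "a \<in> Obj C"
  shows "isomorphic K (omap F a) (omap G a)"
  using assms is_iso_imp_isomorphic unfolding natural_iso_def by blast

lemma Unshift_Shift: "x \<in> Obj K \<Longrightarrow> isomorphic K x (omap (Unshift K) (omap (Shift K) x))"
  using Shift_unit natural_iso_isomorphic by (force simp: id_func_def comp_func_def compose_eq)

lemma Shift_Unshift: "x \<in> Obj K \<Longrightarrow> isomorphic K (omap (Shift K) (omap (Unshift K) x)) x"
  using Shift_counit natural_iso_isomorphic by (force simp: id_func_def comp_func_def compose_eq)

lemma Shift_Obj: "x \<in> Obj K \<Longrightarrow> omap (Shift K) x \<in> Obj K"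
  and Unshift_Obj: "x \<in> Obj K \<Longrightarrow> omap (Unshift K) x \<in> Obj K"
  using is_functorD(1)[OF Shift_functor] is_functorD(1)[OF Unshift_functor] by blast+

end


section \<open>Thick subcategories\<close>

lemma shift_pow_closed:
  assumes "\<And>x. x \<in> M \<Longrightarrow> omap (Shift K) x \<in> M" "\<And>x. x \<in> M \<Longrightarrow> omap (Unshift K) x \<in> M" "x \<in> M"
  shows "shift_pow K i x \<in> M"
proof -
  have "(f ^^ n) x \<in> M" if "\<And>x. x \<in> M \<Longrightarrow> f x \<in> M" for f and n :: nat
    using that assms(3) by (induction n) auto
  then show ?thesis
    using assms(1,2) by (simp add: shift_pow_def)
qed

lemma thick_subcategoryI:
  assumes "M \<subseteq> Obj K"
    and "\<And>z. zero_object K z \<Longrightarrow> z \<in> M"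
    and "\<And>x y. \<lbrakk>x \<in> M; isomorphic K x y\<rbrakk> \<Longrightarrow> y \<in> M"
    and "\<And>x. x \<in> M \<Longrightarrow> omap (Shift K) x \<in> M"
    and "\<And>x. x \<in> M \<Longrightarrow> omap (Unshift K) x \<in> M"
    and "\<And>x y z f g h. \<lbrakk>triangle K x y z f g h; x \<in> M; y \<in> M\<rbrakk> \<Longrightarrow> z \<in> M"
    and "\<And>x y s. \<lbrakk>direct_sum K x y s; s \<in> M\<rbrakk> \<Longrightarrow> x \<in> M \<and> y \<in> M"
  shows "thick_subcategory K M"
  using assms shift_pow_closed[of M K, OF assms(4,5)] unfolding thick_subcategory_def by blast

lemma thick_subset: "A \<subseteq> thick K A"
  by (auto simp: thick_def)

lemma thick_minimal: "\<lbrakk>thick_subcategory K M; A \<subseteq> M\<rbrakk> \<Longrightarrow> thick K A \<subseteq> M"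
  by (auto simp: thick_def)

lemma thick_subset_iff: "thick_subcategory K M \<Longrightarrow> thick K A \<subseteq> M \<longleftrightarrow> A \<subseteq> M"
  using thick_subset[of A K] thick_minimal[of K M A] by blast

lemma thick_of_thick: "thick_subcategory K M \<Longrightarrow> thick K M = M"
  using thick_subset[of M K] thick_minimal[of K M M] by blast

lemma thick_eqI:
  assumes "\<And>M. thick_subcategory K M \<Longrightarrow> A \<subseteq> M \<longleftrightarrow> B \<subseteq> M"
  shows "thick K A = thick K B"
  using assms unfolding thick_def by (metis (mono_tags, lifting))

lemma Thick_simps [simp]:
  "M \<in> carrier (Thick K) \<longleftrightarrow> thick_subcategory K M"
  "(M \<sqsubseteq>\<^bsub>Thick K\<^esub> N) \<longleftrightarrow> M \<subseteq> N"
  by (simp_all add: Thick_def)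

lemma partial_order_Thick: "partial_order (Thick K)"
  by unfold_locales (auto simp: Thick_def)

context triangulated_category
begin

lemma shift_pow_1: "shift_pow K 1 x = omap (Shift K) x" "shift_pow K (- 1) x = omap (Unshift K) x"
  by (simp_all add: shift_pow_def)

lemma isomorphic_Obj: "isomorphic K x y \<Longrightarrow> x \<in> Obj K \<and> y \<in> Obj K"
  by (meson isomorphicE Hom_objects)

lemma thick_subcategory_Obj: "thick_subcategory K (Obj K)"
proof (rule thick_subcategoryI)
  show "z \<in> Obj K" if "zero_object K z" for z
    using that by (simp add: zero_object_iff)
  show "y \<in> Obj K" if "isomorphic K x y" for x y
    using isomorphic_Obj[OF that] by simp
  show "z \<in> Obj K" if "triangle K x y z f g h" for x y z f g h
    using triangle_objects[OF that] by simp
  show "x \<in> Obj K \<and> y \<in> Obj K" if "direct_sum K x y s" for x y s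
    using direct_sum_objects[OF that] by simp
qed (simp_all add: Shift_Obj Unshift_Obj)

lemma thick_subcategory_Inter:
  assumes "\<And>M. M \<in> A \<Longrightarrow> thick_subcategory K M" "A \<noteq> {}"
  shows "thick_subcategory K (\<Inter>A)"
proof -
  have *: "M \<subseteq> Obj K" "\<And>z. zero_object K z \<Longrightarrow> z \<in> M"
    "\<And>x y. \<lbrakk>x \<in> M; isomorphic K x y\<rbrakk> \<Longrightarrow> y \<in> M" "\<And>x i. x \<in> M \<Longrightarrow> shift_pow K i x \<in> M"
    "\<And>x y z f g h. \<lbrakk>triangle K x y z f g h; x \<in> M; y \<in> M\<rbrakk> \<Longrightarrow> z \<in> M"
    "\<And>x y s. \<lbrakk>direct_sum K x y s; s \<in> M\<rbrakk> \<Longrightarrow> x \<in> M \<and> y \<in> M" if "M \<in> A" for M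
    using assms(1)[OF that] unfolding thick_subcategory_def by blast+
  show ?thesis
  proof (rule thick_subcategoryI)
    show "\<Inter>A \<subseteq> Obj K"
      using assms(2) *(1) by blast
    show "omap (Shift K) x \<in> \<Inter>A" if "x \<in> \<Inter>A" for x
      using *(4)[of _ x 1] that by (simp add: shift_pow_1)
    show "omap (Unshift K) x \<in> \<Inter>A" if "x \<in> \<Inter>A" for x
      using *(4)[of _ x "- 1"] that by (simp add: shift_pow_1)
    show "y \<in> \<Inter>A" if "x \<in> \<Inter>A" "isomorphic K x y" for x y
      using that *(3) by (meson InterE InterI)
    show "z \<in> \<Inter>A" if "triangle K x y z f g h" "x \<in> \<Inter>A" "y \<in> \<Inter>A" for x y z f g h
      using that *(5) by (meson InterE InterI)
    show "x \<in> \<Inter>A \<and> y \<in> \<Inter>A" if "direct_sum K x y s" "s \<in> \<Inter>A" for x y s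
      using that *(6) by (meson InterE InterI)
  qed (use *(2) in blast)
qed

lemma thick_subcategory_thick:
  assumes "A \<subseteq> Obj K"
  shows "thick_subcategory K (thick K A)"
  unfolding thick_def using assms thick_subcategory_Obj by (intro thick_subcategory_Inter) auto

lemma thick_subcategory_isomorphic:
  assumes "thick_subcategory K M" "isomorphic K x y"
  shows "x \<in> M \<longleftrightarrow> y \<in> M"
  using assms isomorphic_sym unfolding thick_subcategory_def by blast

lemma thick_subcategory_shift:
  assumes M: "thick_subcategory K M" and x: "x \<in> Obj K"
  shows "omap (Shift K) x \<in> M \<longleftrightarrow> x \<in> M" "omap (Unshift K) x \<in> M \<longleftrightarrow> x \<in> M"
proof -
  have sh: "omap (Shift K) u \<in> M" "omap (Unshift K) u \<in> M" if "u \<in> M" for u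
    using M that shift_pow_1 unfolding thick_subcategory_def by metis+
  show "omap (Shift K) x \<in> M \<longleftrightarrow> x \<in> M"
    using sh(1)[of x] sh(2)[of "omap (Shift K) x"]
      thick_subcategory_isomorphic[OF M Unshift_Shift[OF x]] by blast
  show "omap (Unshift K) x \<in> M \<longleftrightarrow> x \<in> M"
    using sh(2)[of x] sh(1)[of "omap (Unshift K) x"]
      thick_subcategory_isomorphic[OF M Shift_Unshift[OF x]] by blast
qed

lemma thick_subcategory_shift_pow:
  assumes M: "thick_subcategory K M" and x: "x \<in> Obj K"
  shows "shift_pow K i x \<in> M \<longleftrightarrow> x \<in> M"
proof -
  have "(f ^^ n) x \<in> Obj K \<and> ((f ^^ n) x \<in> M \<longleftrightarrow> x \<in> M)"
    if "\<And>u. u \<in> Obj K \<Longrightarrow> f u \<in> Obj K" "\<And>u. u \<in> Obj K \<Longrightarrow> f u \<in> M \<longleftrightarrow> u \<in> M" for f and n :: nat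
    using that x by (induction n) auto
  then show ?thesis
    using thick_subcategory_shift[OF M] Shift_Obj Unshift_Obj by (simp add: shift_pow_def)
qed

text \<open>In the triangle rotated twice, \<open>\<Sigma>y\<close> is the cone of a map from \<open>z\<close> to \<open>\<Sigma>x\<close>.\<close>

lemma thick_subcategory_triangle_middle:
  assumes M: "thick_subcategory K M" and T: "triangle K x y z f g h" and xz: "x \<in> M" "z \<in> M"
  shows "y \<in> M"
proof -
  have cone: "w \<in> M" if "triangle K u v w a b c" "u \<in> M" "v \<in> M" for u v w a b c
    using M that unfolding thick_subcategory_def by blast
  have obj: "x \<in> Obj K" "y \<in> Obj K"
    using triangle_objects[OF T] by auto
  have "omap (Shift K) y \<in> M"
    using cone[OF triangle_rotate[OF triangle_rotate[OF T]] xz(2)]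
      thick_subcategory_shift(1)[OF M obj(1)] xz(1) by simp
  then show ?thesis
    using thick_subcategory_shift(1)[OF M obj(2)] by simp
qed

lemma thick_subcategory_direct_sum:
  assumes M: "thick_subcategory K M" and s: "direct_sum K x y s"
  shows "s \<in> M \<longleftrightarrow> x \<in> M \<and> y \<in> M"
proof
  assume "s \<in> M"
  then show "x \<in> M \<and> y \<in> M"
    using M s unfolding thick_subcategory_def by blast
next
  assume xy: "x \<in> M \<and> y \<in> M"
  obtain z i g h where T: "triangle K x s z i g h" "isomorphic K y z"
    using direct_sum_triangle[OF s] by blast
  then have "z \<in> M"
    using xy thick_subcategory_isomorphic[OF M] by blast
  then show "s \<in> M"
    using thick_subcategory_triangle_middle[OF M T(1)] xy by blast
qed

lemma thick_subcategory_subset_Obj: "thick_subcategory K M \<Longrightarrow> M \<subseteq> Obj K"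
  by (simp add: thick_subcategory_def)

lemma Thick_least:
  assumes "A \<subseteq> carrier (Thick K)"
  shows "least (Thick K) (thick K (\<Union>A)) (Upper (Thick K) A)"
proof -
  have A: "\<And>M. M \<in> A \<Longrightarrow> thick_subcategory K M"
    using assms by auto
  then have "thick_subcategory K (thick K (\<Union>A))"
    using thick_subcategory_subset_Obj by (intro thick_subcategory_thick) blast
  moreover have "M \<subseteq> thick K (\<Union>A)" if "M \<in> A" for M
    using thick_subset[of "\<Union>A" K] that by blast
  moreover have "thick K (\<Union>A) \<subseteq> N" if "thick_subcategory K N" "\<And>M. M \<in> A \<Longrightarrow> M \<subseteq> N" for N
    using that by (intro thick_minimal) auto
  ultimately show ?thesis
    using A by (auto simp: least_def Upper_def)
qed

lemma complete_lattice_Thick: "complete_lattice (Thick K)"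
proof -
  interpret partial_order "Thick K" by (rule partial_order_Thick)
  show ?thesis
  proof unfold_locales
    fix A assume A: "A \<subseteq> carrier (Thick K)"
    then show "\<exists>s. least (Thick K) s (Upper (Thick K) A)"
      using Thick_least by blast
    have "thick_subcategory K (\<Inter>(insert (Obj K) A))"
      using A thick_subcategory_Obj by (intro thick_subcategory_Inter) auto
    moreover have "M \<subseteq> Obj K" if "thick_subcategory K M" for M
      by (rule thick_subcategory_subset_Obj[OF that])
    ultimately have "greatest (Thick K) (\<Inter>(insert (Obj K) A)) (Lower (Thick K) A)"
      using A unfolding greatest_def Lower_def by (auto simp: subset_iff)
    then show "\<exists>i. greatest (Thick K) i (Lower (Thick K) A)"
      by blast
  qed
qed

lemma Thick_sup:
  assumes "A \<subseteq> carrier (Thick K)"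
  shows "\<Squnion>\<^bsub>Thick K\<^esub> A = thick K (\<Union>A)"
proof -
  interpret complete_lattice "Thick K" by (rule complete_lattice_Thick)
  show ?thesis
    by (rule least_unique[OF sup_lub[OF assms] Thick_least[OF assms]])
qed

text \<open>The thick subcategory generated by \<open>A\<close> is the join of those generated by the single objects
  of \<open>A\<close>, so a join-preserving map on \<open>Thick K\<close> is determined by its values at these.\<close>

lemma cjslat_hom_Thick_thick:
  assumes P: "P \<in> cjslat_hom (Thick K) two" and A: "A \<subseteq> Obj K"
  shows "P (thick K A) \<longleftrightarrow> (\<exists>x \<in> A. P (thick K {x}))"
proof -
  let ?S = "(\<lambda>x. thick K {x}) ` A"
  have S: "?S \<subseteq> carrier (Thick K)"
    using A thick_subcategory_thick by auto
  have "thick K A = thick K (\<Union>?S)"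
  proof (rule thick_eqI)
    fix M assume "thick_subcategory K M"
    then show "A \<subseteq> M \<longleftrightarrow> \<Union>?S \<subseteq> M"
      using thick_subset_iff[of K M "{_}"] by auto
  qed
  then have "P (thick K A) = P (\<Squnion>\<^bsub>Thick K\<^esub> ?S)"
    by (simp add: Thick_sup[OF S])
  then show ?thesis
    using P S by (simp add: cjslat_hom_two_iff)
qed

end


section \<open>The action of exact functors\<close>

lemma tcat_homD:
  assumes "F \<in> tcat_hom K L"
  shows "additive_functor K L F"
    and "natural_iso K L (comp_func K F (Shift K)) (comp_func K (Shift L) F) (comparison F)"
    and "triangle K x y z f g h \<Longrightarrow>
        triangle L (omap F x) (omap F y) (omap F z)
          (amap F f) (amap F g) (comparison F x \<cdot>\<^bsub>L\<^esub> amap F h)"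
  using assms unfolding tcat_hom_def by blast+

context
  fixes K :: "('o, 'm) triangulated_category" and L :: "('p, 'n) triangulated_category"
    and F :: "('o, 'm, 'p, 'n) exact_func"
  assumes K: "triangulated_category K" and L: "triangulated_category L" and F: "F \<in> tcat_hom K L"
begin

lemma exact_functor_Obj: "x \<in> Obj K \<Longrightarrow> omap F x \<in> Obj L"
  by (rule is_functorD(1)[OF additive_functorD(1)[OF tcat_homD(1)[OF F]]])

text \<open>\<open>F\<close> carries a comparison with the suspension only. Desuspensions are handled by
  \<open>F(\<Sigma>\<Sigma>\<^sup>-\<^sup>1x) \<cong> F x\<close>, since membership in \<open>N\<close> does not change under \<open>\<Sigma>\<close>.\<close>

lemma thick_subcategory_preimage:
  assumes N: "thick_subcategory L N"
  shows "thick_subcategory K {x \<in> Obj K. omap F x \<in> N}"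
proof -
  interpret K: triangulated_category K by (rule K)
  interpret L: triangulated_category L by (rule L)
  note F = tcat_homD[OF F]
  note fu = additive_functorD(1)[OF F(1)]
  have iso: "omap F x \<in> N \<longleftrightarrow> omap F y \<in> N" if "isomorphic K x y" for x y
    using L.thick_subcategory_isomorphic[OF N
        functor_isomorphic[OF K.category_axioms L.category_axioms fu that]] .
  have sh: "omap F (omap (Shift K) x) \<in> N \<longleftrightarrow> omap F x \<in> N" if x: "x \<in> Obj K" for x
  proof -
    have "isomorphic L (omap F (omap (Shift K) x)) (omap (Shift L) (omap F x))"
      using L.natural_iso_isomorphic[OF F(2) x] x by (simp add: comp_func_def compose_eq)
    then show ?thesis
      using L.thick_subcategory_isomorphic[OF N]
        L.thick_subcategory_shift(1)[OF N exact_functor_Obj[OF x]] by blast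
  qed
  have unsh: "omap F (omap (Unshift K) x) \<in> N \<longleftrightarrow> omap F x \<in> N" if x: "x \<in> Obj K" for x
    using sh[OF K.Unshift_Obj[OF x]] iso[OF K.Shift_Unshift[OF x]] by blast
  show ?thesis
  proof (rule thick_subcategoryI)
    show "z \<in> {x \<in> Obj K. omap F x \<in> N}" if "zero_object K z" for z
      using additive_functor_zero_object[OF K.additive_category_axioms L.additive_category_axioms F(1) that]
        N that unfolding thick_subcategory_def by (simp add: K.zero_object_iff)
    show "y \<in> {x \<in> Obj K. omap F x \<in> N}" if "x \<in> {x \<in> Obj K. omap F x \<in> N}" "isomorphic K x y" for x y
      using that iso K.isomorphic_Obj by blast
    show "z \<in> {x \<in> Obj K. omap F x \<in> N}"
      if "triangle K x y z f g h" "x \<in> {x \<in> Obj K. omap F x \<in> N}" "y \<in> {x \<in> Obj K. omap F x \<in> N}"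
      for x y z f g h
      using that F(3)[OF that(1)] K.triangle_objects[OF that(1)] N
      unfolding thick_subcategory_def by blast
    show "x \<in> {x \<in> Obj K. omap F x \<in> N} \<and> y \<in> {x \<in> Obj K. omap F x \<in> N}"
      if "direct_sum K x y s" "s \<in> {x \<in> Obj K. omap F x \<in> N}" for x y s
      using that K.direct_sum_objects[OF that(1)] L.thick_subcategory_direct_sum[OF N
          additive_functor_direct_sum[OF K.additive_category_axioms L.additive_category_axioms F(1) that(1)]]
      by simp
  qed (auto simp: sh unsh K.Shift_Obj K.Unshift_Obj)
qed

text \<open>By the preceding lemma, taking preimages maps \<open>Thick L\<close> to \<open>Thick K\<close>, right adjoint to
  \<open>Thick_map K L F\<close>. Preservation of joins and compatibility with composition both follow from
  the next equation, which the adjunction yields.\<close>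

lemma thick_image_thick:
  assumes A: "A \<subseteq> Obj K"
  shows "thick L (omap F ` thick K A) = thick L (omap F ` A)"
proof (rule thick_eqI)
  fix N assume N: "thick_subcategory L N"
  have "thick K A \<subseteq> Obj K"
    using thick_minimal[OF triangulated_category.thick_subcategory_Obj[OF K] A] .
  then have "omap F ` thick K A \<subseteq> N \<longleftrightarrow> thick K A \<subseteq> {x \<in> Obj K. omap F x \<in> N}"
    by auto
  also have "\<dots> \<longleftrightarrow> A \<subseteq> {x \<in> Obj K. omap F x \<in> N}"
    by (rule thick_subset_iff[OF thick_subcategory_preimage[OF N]])
  also have "\<dots> \<longleftrightarrow> omap F ` A \<subseteq> N"
    using A by auto
  finally show "omap F ` thick K A \<subseteq> N \<longleftrightarrow> omap F ` A \<subseteq> N" .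
qed

lemma Thick_map_in_hom: "Thick_map K L F \<in> cjslat_hom (Thick K) (Thick L)"
proof -
  interpret K: triangulated_category K by (rule K)
  interpret L: triangulated_category L by (rule L)
  note clK = K.complete_lattice_Thick and clL = L.complete_lattice_Thick
  have image_Obj: "omap F ` M \<subseteq> Obj L" if "thick_subcategory K M" for M
    using K.thick_subcategory_subset_Obj[OF that] exact_functor_Obj by blast
  then have closed: "thick_subcategory L (thick L (omap F ` M))" if "thick_subcategory K M" for M
    using that L.thick_subcategory_thick by blast
  have mono: "thick L (omap F ` M) \<subseteq> thick L (omap F ` M')"
    if "thick_subcategory K M'" "M \<subseteq> M'" for M M'
    by (rule thick_minimal[OF closed[OF that(1)] order_trans[OF image_mono[OF that(2)] thick_subset]])
  have sup: "Thick_map K L F (\<Squnion>\<^bsub>Thick K\<^esub> A) = \<Squnion>\<^bsub>Thick L\<^esub> (Thick_map K L F ` A)"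
    if A: "A \<subseteq> carrier (Thick K)" for A
  proof -
    have img: "Thick_map K L F ` A = (\<lambda>M. thick L (omap F ` M)) ` A"
      using A by (intro image_cong) (auto simp: Thick_map_def)
    have sub: "Thick_map K L F ` A \<subseteq> carrier (Thick L)"
      using A closed by (auto simp: img)
    have "M \<subseteq> Obj K" if "M \<in> A" for M
      using A that by (intro K.thick_subcategory_subset_Obj) auto
    then have Obj: "\<Union>A \<subseteq> Obj K"
      by blast
    have "Thick_map K L F (\<Squnion>\<^bsub>Thick K\<^esub> A) = thick L (omap F ` \<Union>A)"
      using A Obj by (simp add: K.Thick_sup Thick_map_def K.thick_subcategory_thick thick_image_thick)
    also have "\<dots> = thick L (\<Union>(Thick_map K L F ` A))"
    proof (rule thick_eqI)
      fix N assume N: "thick_subcategory L N"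
      have "thick L (omap F ` M) \<subseteq> N \<longleftrightarrow> omap F ` M \<subseteq> N" if "M \<in> A" for M
        by (rule thick_subset_iff[OF N])
      then show "omap F ` \<Union>A \<subseteq> N \<longleftrightarrow> \<Union>(Thick_map K L F ` A) \<subseteq> N"
        unfolding img by blast
    qed
    finally show ?thesis
      by (simp add: L.Thick_sup[OF sub])
  qed
  have "isotone (Thick K) (Thick L) (Thick_map K L F)"
    using mono partial_order.axioms(1)[OF partial_order_Thick[of K]]
      partial_order.axioms(1)[OF partial_order_Thick[of L]] unfolding isotone_def
    by (auto simp: Thick_map_def)
  then show ?thesis
    using sup closed clK clL by (auto simp: cjslat_hom_def sup_pres_def Thick_map_def)
qed

end

lemma Thick_map_id:
  assumes "triangulated_category K"
  shows "Thick_map K K (tcat_id K) = (\<lambda>M \<in> carrier (Thick K). M)"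
proof (rule ext)
  fix M
  have "omap (tcat_id K) ` M = M" if "thick_subcategory K M"
    using triangulated_category.thick_subcategory_subset_Obj[OF assms that]
    by (force simp: tcat_id_def)
  then show "Thick_map K K (tcat_id K) M = (\<lambda>M \<in> carrier (Thick K). M) M"
    by (simp add: Thick_map_def thick_of_thick)
qed

lemma Thick_map_comp:
  assumes K: "triangulated_category K" and L: "triangulated_category L" and M: "triangulated_category M"
    and F: "F \<in> tcat_hom K L" and G: "G \<in> tcat_hom L M"
  shows "Thick_map K M (tcat_comp K M G F) =
    compose (carrier (Thick K)) (Thick_map L M G) (Thick_map K L F)"
proof (rule ext)
  fix N
  show "Thick_map K M (tcat_comp K M G F) N =
    compose (carrier (Thick K)) (Thick_map L M G) (Thick_map K L F) N"
  proof (cases "thick_subcategory K N")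
    case True
    have N: "N \<subseteq> Obj K"
      by (rule triangulated_category.thick_subcategory_subset_Obj[OF K True])
    then have FN: "omap F ` N \<subseteq> Obj L"
      using exact_functor_Obj[OF K L F] by blast
    have "omap (tcat_comp K M G F) ` N = omap G ` omap F ` N"
      unfolding image_image using N by (intro image_cong) (auto simp: tcat_comp_def compose_eq)
    then show ?thesis
      using True thick_image_thick[OF L M G FN] triangulated_category.thick_subcategory_thick[OF L FN]
      by (simp add: Thick_map_def compose_eq)
  qed (simp add: Thick_map_def compose_def)
qed


section \<open>Supports\<close>

context triangulated_category
begin

text \<open>In terms of supports: for a point \<open>p\<close>, membership in the open set of \<open>thick K A\<close> is membership in
  the support of some object of \<open>A\<close>. Relations between supports thus follow from equalities of
  generated thick subcategories.\<close>

lemma frame_hom_d_unit_thick: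
  fixes p :: "('o set \<Rightarrow> bool) set \<Rightarrow> bool"
  assumes p: "p \<in> frame_hom (d_frame (Thick K)) two" and A: "A \<subseteq> Obj K"
  shows "p (d_unit (Thick K) (thick K A)) \<longleftrightarrow> (\<exists>x \<in> A. p (d_unit (Thick K) (thick K {x})))"
proof -
  have "compose (carrier (Thick K)) p (d_unit (Thick K)) \<in> cjslat_hom (Thick K) two"
    by (rule cjslat_hom_compose[OF d_unit_in_hom[OF complete_lattice_Thick] frame_hom_imp_cjslat_hom[OF p]])
  then have "compose (carrier (Thick K)) p (d_unit (Thick K)) (thick K A) \<longleftrightarrow>
      (\<exists>x \<in> A. compose (carrier (Thick K)) p (d_unit (Thick K)) (thick K {x}))"
    using cjslat_hom_Thick_thick A by blast
  moreover have "compose (carrier (Thick K)) p (d_unit (Thick K)) (thick K B) = p (d_unit (Thick K) (thick K B))"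
    if "B \<subseteq> Obj K" for B
    using thick_subcategory_thick[OF that] by (simp add: compose_eq)
  moreover have "(\<exists>x \<in> A. compose (carrier (Thick K)) p (d_unit (Thick K)) (thick K {x})) \<longleftrightarrow>
      (\<exists>x \<in> A. p (d_unit (Thick K) (thick K {x})))"
    using A calculation(2)[of "{_}"] by (intro bex_cong) auto
  ultimately show ?thesis
    using A by simp
qed

end

lemma support_datum_supp:
  assumes "triangulated_category K"
  shows "support_datum K (fSpcnt K) (supp K)"
proof -
  interpret triangulated_category K by fact
  define S where "S A = {p \<in> frame_hom (d_frame (Thick K)) two. p (d_unit (Thick K) (thick K A))}" for A
  have S: "S A = (\<Union>x \<in> A. supp K x)" if "A \<subseteq> Obj K" for A
    unfolding S_def supp_def pt_open_def using frame_hom_d_unit_thick[OF _ that] by blast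
  have S_eq: "S A = S B" if "\<And>M. thick_subcategory K M \<Longrightarrow> A \<subseteq> M \<longleftrightarrow> B \<subseteq> M" for A B
  proof -
    have "thick K A = thick K B"
      by (rule thick_eqI[OF that])
    then show ?thesis
      by (simp add: S_def)
  qed
  show ?thesis
    unfolding support_datum_def
  proof (intro conjI ballI allI impI)
    fix x assume x: "x \<in> Obj K"
    have "d_unit (Thick K) (thick K {x}) \<in> carrier (d_frame (Thick K))"
      using x thick_subcategory_thick by (intro d_unit_closed) simp
    then show "openin (fSpcnt K) (supp K x)"
      using openin_pt_iff[OF is_frame_d_frame] by (auto simp: fSpcnt_def supp_def)
    fix i
    have "shift_pow K i x \<in> Obj K"
      using thick_subcategory_Obj x unfolding thick_subcategory_def by blast
    then show "supp K (shift_pow K i x) = supp K x"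
      using S_eq[of "{shift_pow K i x}" "{x}"] S[of "{shift_pow K i x}"] S[of "{x}"] x
        thick_subcategory_shift_pow by simp
  next
    fix z assume z: "zero_object K z"
    have "S {z} = S {}"
      using z by (intro S_eq) (simp add: thick_subcategory_def)
    then show "supp K z = {}"
      using S[of "{z}"] S[of "{}"] z by (simp add: zero_object_iff)
  next
    fix x y s assume s: "direct_sum K x y s"
    have "S {s} = S {x, y}"
      using thick_subcategory_direct_sum[OF _ s] by (intro S_eq) simp
    then show "supp K s = supp K x \<union> supp K y"
      using S[of "{s}"] S[of "{x, y}"] direct_sum_objects[OF s] by simp
  next
    fix x y z f g h assume T: "triangle K x y z f g h"
    have "S {x, z} = S {x, y, z}"
      using thick_subcategory_triangle_middle[OF _ T] by (intro S_eq) auto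
    then show "supp K y \<subseteq> supp K x \<union> supp K z"
      using S[of "{x, z}"] S[of "{x, y, z}"] triangle_objects[OF T] by auto
  qed
qed

context
  fixes K :: "('o, 'm) triangulated_category" and X :: "'x topology" and \<sigma> :: "'o \<Rightarrow> 'x set"
  assumes K: "triangulated_category K" and \<sigma>: "support_datum K X \<sigma>"
begin

text \<open>Closure under cones uses rotation: the axiom on triangles bounds the middle object, and a cone is
  the middle object of the rotated triangle.\<close>

lemma thick_subcategory_not_supported: "thick_subcategory K {x \<in> Obj K. t \<notin> \<sigma> x}"
proof -
  interpret triangulated_category K by (rule K)
  have zero: "\<And>z. zero_object K z \<Longrightarrow> \<sigma> z = {}"
    and sp: "\<And>x i. x \<in> Obj K \<Longrightarrow> \<sigma> (shift_pow K i x) = \<sigma> x"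
    and ds: "\<And>x y s. direct_sum K x y s \<Longrightarrow> \<sigma> s = \<sigma> x \<union> \<sigma> y"
    and tri: "\<And>x y z f g h. triangle K x y z f g h \<Longrightarrow> \<sigma> y \<subseteq> \<sigma> x \<union> \<sigma> z"
    using \<sigma> unfolding support_datum_def by blast+
  show ?thesis
  proof (rule thick_subcategoryI)
    show "z \<in> {x \<in> Obj K. t \<notin> \<sigma> x}" if "zero_object K z" for z
      using that zero by (simp add: zero_object_iff)
    show "y \<in> {x \<in> Obj K. t \<notin> \<sigma> x}" if "x \<in> {x \<in> Obj K. t \<notin> \<sigma> x}" "isomorphic K x y" for x y
    proof -
      obtain z where "zero_object K z"
        using ex_zero_object by blast
      then have "\<sigma> y = \<sigma> x"
        using ds[OF direct_sum_zero_object[OF that(2)]] zero by simp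
      then show ?thesis
        using that isomorphic_Obj by simp
    qed
    show "omap (Shift K) x \<in> {x \<in> Obj K. t \<notin> \<sigma> x}" if "x \<in> {x \<in> Obj K. t \<notin> \<sigma> x}" for x
      using that sp[of x 1] Shift_Obj by (simp add: shift_pow_1)
    show "omap (Unshift K) x \<in> {x \<in> Obj K. t \<notin> \<sigma> x}" if "x \<in> {x \<in> Obj K. t \<notin> \<sigma> x}" for x
      using that sp[of x "- 1"] Unshift_Obj by (simp add: shift_pow_1)
    show "z \<in> {x \<in> Obj K. t \<notin> \<sigma> x}"
      if T: "triangle K x y z f g h" and "x \<in> {x \<in> Obj K. t \<notin> \<sigma> x}" "y \<in> {x \<in> Obj K. t \<notin> \<sigma> x}"
      for x y z f g h
      using that tri[OF triangle_rotate[OF T]] sp[of x 1] triangle_objects[OF T]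
      by (auto simp: shift_pow_1)
    show "x \<in> {x \<in> Obj K. t \<notin> \<sigma> x} \<and> y \<in> {x \<in> Obj K. t \<notin> \<sigma> x}"
      if s: "direct_sum K x y s" and "s \<in> {x \<in> Obj K. t \<notin> \<sigma> x}" for x y s
      using that ds[OF s] direct_sum_objects[OF s] by simp
  qed simp
qed

text \<open>A point \<open>t\<close> is sent to the point of the spectrum given by the thick subcategory \<open>N t\<close> of the
  objects not supported at \<open>t\<close>. This is forced: the values of \<open>f t\<close> at \<open>thick K {x}\<close> are
  prescribed by \<open>\<sigma>\<close>, and they determine the point.\<close>

lemma supp_universal:
  "\<exists>!f. f \<in> sob_hom X (fSpcnt K) \<and> (\<forall>x \<in> Obj K. \<sigma> x = {t \<in> topspace X. f t \<in> supp K x})"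
proof -
  interpret triangulated_category K by (rule K)
  let ?T = "Thick K" and ?D = "d_frame (Thick K)"
  define N where "N t = {x \<in> Obj K. t \<notin> \<sigma> x}" for t
  have N: "thick_subcategory K (N t)" for t
    unfolding N_def by (rule thick_subcategory_not_supported)
  have open_\<sigma>: "openin X (\<sigma> x)" if "x \<in> Obj K" for x
    using \<sigma> that by (simp add: support_datum_def)
  define a where "a t = not_below ?T (N t)" for t
  have a_hom: "a t \<in> cjslat_hom ?T two" for t
    unfolding a_def using N complete_lattice_Thick by (intro not_below_in_hom) simp_all
  have a_unit: "{t \<in> topspace X. a t \<in> d_basic ?T M} = (\<Union>x \<in> M. \<sigma> x)" if M: "thick_subcategory K M" for M
  proof -
    have "a t \<in> d_basic ?T M \<longleftrightarrow> \<not> M \<subseteq> N t" for t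
      using a_hom[of t] M by (simp add: d_basic_def a_def not_below_def)
    also have "\<not> M \<subseteq> N t \<longleftrightarrow> t \<in> (\<Union>x \<in> M. \<sigma> x)" for t
      using thick_subcategory_subset_Obj[OF M] by (auto simp: N_def)
    finally have "{t \<in> topspace X. a t \<in> d_basic ?T M} = topspace X \<inter> (\<Union>x \<in> M. \<sigma> x)"
      by blast
    also have "\<dots> = (\<Union>x \<in> M. \<sigma> x)"
      using openin_subset[OF open_\<sigma>] thick_subcategory_subset_Obj[OF M] by blast
    finally show ?thesis .
  qed
  have a_cont: "continuous_map X (d_space ?T) a"
    unfolding d_space_def
  proof (rule continuous_on_generated_topo)
    fix U assume "U \<in> insert (cjslat_hom ?T two) (d_basic ?T ` carrier ?T)"
    then consider "U = cjslat_hom ?T two" | M where "thick_subcategory K M" "U = d_basic ?T M"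
      by auto
    then show "openin X (a -` U \<inter> topspace X)"
    proof cases
      case 1
      then have "a -` U \<inter> topspace X = topspace X"
        using a_hom by auto
      then show ?thesis by simp
    next
      case 2
      then have "a -` U \<inter> topspace X = (\<Union>x \<in> M. \<sigma> x)"
        using a_unit[OF 2(1)] by auto
      moreover have "openin X (\<sigma> x)" if "x \<in> M" for x
        using open_\<sigma> thick_subcategory_subset_Obj[OF 2(1)] that by blast
      ultimately show ?thesis
        by (auto intro!: openin_Union)
    qed
  qed (use a_hom in auto)
  define f where "f = (\<lambda>t \<in> topspace X. \<lambda>U \<in> carrier ?D. a t \<in> U)"
  have f_pt: "f t \<in> frame_hom ?D two" if "t \<in> topspace X" for t
    using that frame_hom_opens_frame_point[of "a t" "d_space ?T"] a_hom
    by (simp add: f_def d_frame_def topspace_d_space)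
  have f_open: "{t \<in> topspace X. f t \<in> pt_open ?D U} = {t \<in> topspace X. a t \<in> U}"
    if "U \<in> carrier ?D" for U
    using that f_pt by (auto simp: pt_open_def f_def)
  have "openin X {t \<in> topspace X. f t \<in> V}" if "openin (pt ?D) V" for V
  proof -
    obtain U where U: "U \<in> carrier ?D" "V = pt_open ?D U"
      using \<open>openin (pt ?D) V\<close> openin_pt_iff[OF is_frame_d_frame] by blast
    then have "openin (d_space ?T) U"
      by (simp add: d_frame_def)
    then show ?thesis
      using a_cont U f_open[OF U(1)] by (simp add: continuous_map_def)
  qed
  then have f_hom: "f \<in> sob_hom X (fSpcnt K)"
    using f_pt by (auto simp: sob_hom_def fSpcnt_def continuous_map_def f_def
        topspace_pt[OF is_frame_d_frame])
  have f_supp: "\<sigma> x = {t \<in> topspace X. f t \<in> supp K x}" if x: "x \<in> Obj K" for x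
  proof -
    have th: "thick_subcategory K (thick K {x})"
      using x thick_subcategory_thick by simp
    then have "d_unit ?T (thick K {x}) = d_basic ?T (thick K {x})"
      by (simp add: d_unit_def)
    then have "{t \<in> topspace X. f t \<in> supp K x} = {t \<in> topspace X. \<not> thick K {x} \<subseteq> N t}"
      using f_open[OF d_unit_closed, of "thick K {x}"] th a_hom
      by (auto simp: supp_def d_basic_def a_def not_below_def)
    also have "\<dots> = \<sigma> x"
      using thick_subset_iff[OF N, of "{x}"] x openin_subset[OF open_\<sigma>[OF x]]
      by (auto simp: N_def)
    finally show ?thesis ..
  qed
  show ?thesis
  proof (rule ex1I[of _ f])
    show "f \<in> sob_hom X (fSpcnt K) \<and> (\<forall>x \<in> Obj K. \<sigma> x = {t \<in> topspace X. f t \<in> supp K x})"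
      using f_hom f_supp by blast
    fix f' assume f': "f' \<in> sob_hom X (fSpcnt K) \<and>
        (\<forall>x \<in> Obj K. \<sigma> x = {t \<in> topspace X. f' t \<in> supp K x})"
    have "f' t = f t" if t: "t \<in> topspace X" for t
    proof (rule frame_hom_d_frame_eqI[OF complete_lattice_Thick spatial_frame_two])
      show pts: "f' t \<in> frame_hom ?D two" "f t \<in> frame_hom ?D two"
        using f' f_pt t by (auto simp: sob_hom_def fSpcnt_def topspace_pt[OF is_frame_d_frame])
      fix M assume "M \<in> carrier ?T"
      then have "thick_subcategory K M"
        by simp
      then have M: "M \<subseteq> Obj K" "thick K M = M"
        by (rule thick_subcategory_subset_Obj, rule thick_of_thick)
      have "f' t (d_unit ?T (thick K {x})) \<longleftrightarrow> f t (d_unit ?T (thick K {x}))" if x: "x \<in> M" for x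
      proof -
        have "f' t \<in> supp K x \<longleftrightarrow> f t \<in> supp K x"
          using f' f_supp t x M(1) by blast
        then show ?thesis
          using pts by (simp add: supp_def pt_open_def)
      qed
      then show "f' t (d_unit ?T M) = f t (d_unit ?T M)"
        using frame_hom_d_unit_thick[OF pts(1) M(1)] frame_hom_d_unit_thick[OF pts(2) M(1)] M(2)
        by simp
    qed
    then show "f' = f"
      using f' f_hom by (intro extensionalityI[of _ "topspace X"]) (auto simp: sob_hom_def PiE_def)
  qed
qed

end


section \<open>The spectrum functor\<close>

theorem mainTheorem3:
  fixes K :: "('o, 'm) triangulated_category"
    and L :: "('p, 'n) triangulated_category"
    and M :: "('q, 'r) triangulated_category"
  assumes "triangulated_category K" and "triangulated_category L" and "triangulated_category M"
  shows
    "sober_space (fSpcnt K) \<and>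
     (\<forall>F \<in> tcat_hom K L. fSpcnt_map K L F \<in> sob_hom (fSpcnt L) (fSpcnt K)) \<and>
     fSpcnt_map K K (tcat_id K) = (\<lambda>t \<in> topspace (fSpcnt K). t) \<and>
     (\<forall>F \<in> tcat_hom K L. \<forall>G \<in> tcat_hom L M.
        fSpcnt_map K M (tcat_comp K M G F) =
          compose (topspace (fSpcnt M)) (fSpcnt_map K L F) (fSpcnt_map L M G)) \<and>
     support_datum K (fSpcnt K) (supp K) \<and>
     (\<forall>(X :: 'x topology) \<sigma>. sober_space X \<and> support_datum K X \<sigma> \<longrightarrow>
        (\<exists>!f. f \<in> sob_hom X (fSpcnt K) \<and>
              (\<forall>x \<in> Obj K. \<sigma> x = {t \<in> topspace X. f t \<in> supp K x})))"
proof (intro conjI ballI allI impI)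
  note cl = assms[THEN triangulated_category.complete_lattice_Thick]
  show "sober_space (fSpcnt K)"
    unfolding fSpcnt_def by (rule sober_space_pt[OF is_frame_d_frame])
  show "fSpcnt_map K L F \<in> sob_hom (fSpcnt L) (fSpcnt K)" if "F \<in> tcat_hom K L" for F
    unfolding fSpcnt_def fSpcnt_map_def
    using Thick_map_in_hom[OF assms(1,2) that]
    by (intro pt_map_in_sob_hom is_frame_d_frame d_map_in_hom cl)
  show "fSpcnt_map K K (tcat_id K) = (\<lambda>t \<in> topspace (fSpcnt K). t)"
    by (simp add: fSpcnt_def fSpcnt_map_def Thick_map_id assms(1) d_map_id cl pt_map_id
        topspace_pt is_frame_d_frame)
  show "fSpcnt_map K M (tcat_comp K M G F) =
      compose (topspace (fSpcnt M)) (fSpcnt_map K L F) (fSpcnt_map L M G)"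
    if F: "F \<in> tcat_hom K L" and G: "G \<in> tcat_hom L M" for F G
  proof -
    note f = Thick_map_in_hom[OF assms(1,2) F] and g = Thick_map_in_hom[OF assms(2,3) G]
    show ?thesis
      unfolding fSpcnt_def fSpcnt_map_def Thick_map_comp[OF assms F G] d_map_compose[OF cl f g]
        pt_map_compose[OF d_map_in_hom[OF cl(1,2) f] d_map_in_hom[OF cl(2,3) g]]
        topspace_pt[OF is_frame_d_frame] ..
  qed
  show "support_datum K (fSpcnt K) (supp K)"
    by (rule support_datum_supp[OF assms(1)])
  show "\<exists>!f. f \<in> sob_hom X (fSpcnt K) \<and>
      (\<forall>x \<in> Obj K. \<sigma> x = {t \<in> topspace X. f t \<in> supp K x})"
    if "sober_space X \<and> support_datum K X \<sigma>" for X :: "'x topology" and \<sigma>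
    using that supp_universal[OF assms(1)] by blast
qed

end
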